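(* As formal power series, \[ A_{\{1,3\}}(x,y) = \frac{1-x^2y - x^3y}{(1-x^2y - x^3y)(1-xy-x^3y^{3})-2x^3y^2(1+x)}, \] and for any integer $c \geq 1$, $A_{\{c,3c\}}(x,y) = A_{\{1,3\}}(x^c,y^c)$.
   Context: A composition of $n$ is an ordered list of positive integers (parts) with sum $n$; the empty list is the unique composition of $0$. A meander on $n$ nodes is a pair $\frac{\lambda}{\mu}$ of compositions of $n$, viewed as a planar (multi)graph on vertices $1,\dots,n$: for each part $a$ of $\lambda$, occupying the consecutive vertices $p+1,\dots,p+a$ (where $p$ is the sum of the preceding parts), there is an upper edge joining $p+i$ and $p+a+1-i$ for each $1\le i\le \lfloor a/2\rfloor$; lower edges are defined in the same way from $\mu$. If the same two vertices are joined by both an upper and a lower edge, both edges are kept and form a cycle. Every connected component is a cycle or a path (an isolated vertex counts as a path). The index is $\operatorname{ind}(\frac{\lambda}{\mu}) = 2c+p$, where here $c$ is the number of cycles and $p$ is the number of paths (this equals the index of the associated seaweed subalgebra of $\mathfrak{gl}_n$). For a set $J$ of positive integers, $a^J_{n,k}$ is the number of meanders $\frac{\lambda}{\mu}$ on $n$ nodes of index $k$ such that all parts of $\lambda$ and $\mu$ lie in $J$, and $A_J(x,y)=\sum_{n,k\ge 0} a^J_{n,k}x^ny^k$ (the empty meander gives $a^J_{0,0}=1$). *)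

theory Defs
  imports "HOL-Computational_Algebra.Formal_Power_Series"
begin

unbundle fps_syntax

definition composition :: "nat \<Rightarrow> nat list \<Rightarrow> bool" where
  "composition n as \<longleftrightarrow> (\<forall>a\<in>set as. 0 < a) \<and> sum_list as = n"

text \<open>
  A finite undirected multigraph is given by a vertex set \<open>V\<close>, a set \<open>E\<close> of edge names and a
  map \<open>ends\<close> sending an edge name to its set of end points, so that parallel edges have
  different names.
\<close>

definition connected_rel :: "'v set \<Rightarrow> 'e set \<Rightarrow> ('e \<Rightarrow> 'v set) \<Rightarrow> ('v \<times> 'v) set" where
  "connected_rel V E ends =
    {(u, v) \<in> V \<times> V. (u, v) \<in> {(a, b). \<exists>e\<in>E. ends e = {a, b}}\<^sup>*}"

definition components :: "'v set \<Rightarrow> 'e set \<Rightarrow> ('e \<Rightarrow> 'v set) \<Rightarrow> 'v set set" where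
  "components V E ends = V // connected_rel V E ends"

definition edges_within :: "'e set \<Rightarrow> ('e \<Rightarrow> 'v set) \<Rightarrow> 'v set \<Rightarrow> 'e set" where
  "edges_within E ends C = {e \<in> E. ends e \<subseteq> C}"

text \<open>
  The submultigraph induced on \<open>C\<close> is a path: its vertices can be listed without repetition as
  \<open>v\<^sub>0, \<dots>, v\<^sub>m\<close> and its edges as \<open>e\<^sub>0, \<dots>, e\<^sub>m\<^sub>-\<^sub>1\<close>, with \<open>e\<^sub>i\<close> joining \<open>v\<^sub>i\<close> and \<open>v\<^sub>i\<^sub>+\<^sub>1\<close>.
  The case \<open>m = 0\<close> is an isolated vertex.
\<close>

definition is_path :: "'e set \<Rightarrow> ('e \<Rightarrow> 'v set) \<Rightarrow> 'v set \<Rightarrow> bool" where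
  "is_path E ends C \<longleftrightarrow>
    (\<exists>vs es. distinct vs \<and> set vs = C \<and> distinct es \<and> set es = edges_within E ends C \<and>
       length vs = Suc (length es) \<and>
       (\<forall>i<length es. ends (es ! i) = {vs ! i, vs ! Suc i}))"

text \<open>
  The same for a cycle, with \<open>e\<^sub>i\<close> joining \<open>v\<^sub>i\<close> and its cyclic successor. Two vertices joined by
  two parallel edges form a cycle; there are no loops in a meander.
\<close>

definition is_cycle :: "'e set \<Rightarrow> ('e \<Rightarrow> 'v set) \<Rightarrow> 'v set \<Rightarrow> bool" where
  "is_cycle E ends C \<longleftrightarrow>
    (\<exists>vs es. distinct vs \<and> set vs = C \<and> distinct es \<and> set es = edges_within E ends C \<and>
       length vs = length es \<and> 2 \<le> length vs \<and>
       (\<forall>i<length es. ends (es ! i) = {vs ! i, vs ! (Suc i mod length vs)}))"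

definition arcs :: "nat list \<Rightarrow> nat set set" where
  "arcs as = {{p + i, p + a + 1 - i} | j p a i.
     j < length as \<and> p = sum_list (take j as) \<and> a = as ! j \<and> 1 \<le> i \<and> i \<le> a div 2}"

text \<open>
  The edge set of a meander is the disjoint sum of the upper and the lower arcs, so an arc that
  occurs on both sides gives two edges.
\<close>

definition meander_edges :: "nat list \<Rightarrow> nat list \<Rightarrow> (nat set + nat set) set" where
  "meander_edges l m = arcs l <+> arcs m"

definition meander_ends :: "nat set + nat set \<Rightarrow> nat set" where
  "meander_ends = case_sum (\<lambda>e. e) (\<lambda>e. e)"

definition meander_components :: "nat list \<Rightarrow> nat list \<Rightarrow> nat set set" where
  "meander_components l m = components {1..sum_list l} (meander_edges l m) meander_ends"

definition meander_index :: "nat list \<Rightarrow> nat list \<Rightarrow> nat" where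
  "meander_index l m =
     2 * card {C \<in> meander_components l m. is_cycle (meander_edges l m) meander_ends C} +
     card {C \<in> meander_components l m. is_path (meander_edges l m) meander_ends C}"

definition meander_count :: "nat set \<Rightarrow> nat \<Rightarrow> nat \<Rightarrow> nat" where
  "meander_count J n k =
     card {(l, m). composition n l \<and> composition n m \<and> set l \<subseteq> J \<and> set m \<subseteq> J \<and>
                   meander_index l m = k}"

text \<open>
  Power series in \<open>x\<close> and \<open>y\<close> are series in \<open>x\<close> whose coefficients are series in \<open>y\<close>; the
  coefficient of \<open>x\<^sup>n y\<^sup>k\<close> in \<open>F\<close> is \<open>F $ n $ k\<close>.
\<close>

abbreviation var_x :: "rat fps fps" where
  "var_x \<equiv> fps_X"

abbreviation var_y :: "rat fps fps" where
  "var_y \<equiv> fps_const fps_X"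

definition meander_gf :: "nat set \<Rightarrow> rat fps fps" where
  "meander_gf J = Abs_fps (\<lambda>n. Abs_fps (\<lambda>k. of_nat (meander_count J n k)))"

text \<open>
  \<open>F(x\<^sup>c, y\<^sup>c)\<close>. The library's composition \<open>oo\<close> is a genuine substitution only when the inner
  series has zero constant term, so this is meaningful for \<open>c \<ge> 1\<close> only.
\<close>

definition subst_powers :: "nat \<Rightarrow> rat fps fps \<Rightarrow> rat fps fps" where
  "subst_powers c F = Abs_fps (\<lambda>n. F $ n oo fps_X ^ c) oo fps_X ^ c"

text \<open>
  The coefficients \<open>rat fps\<close> do not form a field, but division by a series whose constant
  coefficient is \<open>1\<close> is exact.
\<close>

lemma bivariate_divide_mult_cancel:
  fixes F G :: "rat fps fps"
  assumes "G $ 0 = 1"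
  shows "F / G * G = F"
proof -
  have "G * inverse G = 1"
    unfolding fps_inverse_def using assms
    by (intro fps_right_inverse) simp
  moreover have "F / G = F * inverse G"
    using assms by (simp add: fps_divide_unit)
  ultimately show ?thesis
    by (simp add: mult.assoc mult.commute[of "inverse G"])
qed

end

theory Submission
  imports Defs
begin

text \<open>
  Let \<open>U\<close> and \<open>L\<close> be the involutions of the vertices that reflect each upper and each lower part.
  A cycle of the meander splits into two orbits of \<open>U \<circ> L\<close>, its vertices of even and of odd
  position, whereas the vertices of a path form a single orbit. So the index is the number of orbits of the
  permutation \<open>U \<circ> L\<close>. Multiplying all parts by \<open>c\<close> replaces vertices by blocks of length \<open>c\<close>; each of \<open>U\<close>
  and \<open>L\<close> reverses the blocks, so the composite preserves positions in them and has \<open>c\<close> times as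
  many orbits.

  For parts 1 and 3, removing the first few parts changes the number of orbits in a controlled way;
  for example \<open>ind (3l | 1 3 m) = 1 + ind (l | 1 m)\<close>. The generating functions of all pairs, of those whose
  lower composition begins with 1 or with 1, 1, and of those whose upper composition moreover begins with 3,
  therefore satisfy a linear system, which is solved over the integral domain of power series.
\<close>

section \<open>Orbits of a self-map\<close>

text \<open>Steps are allowed in both directions, which makes this an equivalence for an arbitrary
  map. For a permutation of a finite \<open>V\<close> the classes are its cycles.\<close>

definition orbit_rel :: "('a \<Rightarrow> 'a) \<Rightarrow> 'a set \<Rightarrow> ('a \<times> 'a) set" where
  "orbit_rel p V = {(u, v) \<in> V \<times> V. (u, v) \<in> {(a, b). a \<in> V \<and> b = p a \<or> b \<in> V \<and> a = p b}\<^sup>*}"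

definition orbit_count :: "('a \<Rightarrow> 'a) \<Rightarrow> 'a set \<Rightarrow> nat" where
  "orbit_count p V = card (V // orbit_rel p V)"

lemma equiv_rtrancl_restrict:
  assumes "sym R"
  shows "equiv V {(u, v) \<in> V \<times> V. (u, v) \<in> R\<^sup>*}"
proof (rule equivI)
  show "sym {(u, v) \<in> V \<times> V. (u, v) \<in> R\<^sup>*}"
    using sym_rtrancl[OF assms] by (auto simp: sym_def)
  show "trans {(u, v) \<in> V \<times> V. (u, v) \<in> R\<^sup>*}"
    by (auto simp: trans_def)
qed (auto simp: refl_on_def)

lemma equiv_orbit_rel: "equiv V (orbit_rel p V)"
  unfolding orbit_rel_def by (rule equiv_rtrancl_restrict) (auto simp: sym_def)

lemma orbit_rel_refl: "v \<in> V \<Longrightarrow> (v, v) \<in> orbit_rel p V"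
  by (simp add: orbit_rel_def)

lemma orbit_rel_sym: "(u, v) \<in> orbit_rel p V \<Longrightarrow> (v, u) \<in> orbit_rel p V"
  using equiv_orbit_rel by (metis equivE symD)

lemma orbit_rel_trans:
  "(u, v) \<in> orbit_rel p V \<Longrightarrow> (v, w) \<in> orbit_rel p V \<Longrightarrow> (u, w) \<in> orbit_rel p V"
  using equiv_orbit_rel by (metis equivE transD)

lemma orbit_rel_step: "v \<in> V \<Longrightarrow> p v \<in> V \<Longrightarrow> (v, p v) \<in> orbit_rel p V"
  by (auto simp: orbit_rel_def)

text \<open>Each generating step of \<open>q\<close> is realised by some chain of \<open>p\<close>,
  so chains of \<open>q\<close> translate into chains of \<open>p\<close>. This compares maps that
  differ by a detour through further points.\<close>

lemma orbit_rel_mono: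
  assumes "V \<subseteq> W" "\<And>v. v \<in> V \<Longrightarrow> (v, q v) \<in> orbit_rel p W"
  shows "orbit_rel q V \<subseteq> orbit_rel p W"
proof clarify
  fix u v assume uv: "(u, v) \<in> orbit_rel q V"
  define S where "S = {(a, b). a \<in> V \<and> b = q a \<or> b \<in> V \<and> a = q b}"
  have "(u, v) \<in> S\<^sup>*" and u: "u \<in> V"
    using uv by (auto simp: orbit_rel_def S_def)
  from this(1) show "(u, v) \<in> orbit_rel p W"
  proof (induction rule: rtrancl_induct)
    case base
    show ?case using u assms(1) by (intro orbit_rel_refl) auto
  next
    case (step y z)
    then have "(y, z) \<in> orbit_rel p W"
      using assms(2) orbit_rel_sym[OF assms(2)] by (auto simp: S_def)
    with step.IH show ?case by (rule orbit_rel_trans)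
  qed
qed

lemma orbit_rel_invariant:
  assumes "(u, v) \<in> orbit_rel p V" "\<And>v. v \<in> V \<Longrightarrow> r (p v) = r v"
  shows "r u = r v"
proof -
  have "(u, v) \<in> {(a, b). a \<in> V \<and> b = p a \<or> b \<in> V \<and> a = p b}\<^sup>*"
    using assms(1) by (simp add: orbit_rel_def)
  then show ?thesis
    by (induction rule: rtrancl_induct) (auto simp: assms(2))
qed

section \<open>Counting orbits by complete invariants\<close>

lemma card_image_cong_kernel:
  assumes "\<And>u v. u \<in> V \<Longrightarrow> v \<in> V \<Longrightarrow> f u = f v \<longleftrightarrow> g u = g v"
  shows "card (f ` V) = card (g ` V)"
proof (rule bij_betw_same_card)
  have "g (inv_into V f (f v)) = g v" if "v \<in> V" for v
    using that assms by (metis f_inv_into_f imageI inv_into_into)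
  then show "bij_betw (\<lambda>z. g (inv_into V f z)) (f ` V) (g ` V)"
    using assms by (intro bij_betwI') auto
qed

definition orbit_class :: "('a \<Rightarrow> 'a) \<Rightarrow> 'a set \<Rightarrow> 'a \<Rightarrow> 'a set" where
  "orbit_class p V v = orbit_rel p V `` {v}"

lemma orbit_class_eq_iff:
  "u \<in> V \<Longrightarrow> v \<in> V \<Longrightarrow> orbit_class p V u = orbit_class p V v \<longleftrightarrow> (u, v) \<in> orbit_rel p V"
  unfolding orbit_class_def by (rule eq_equiv_class_iff[OF equiv_orbit_rel])

lemma orbit_class_step:
  "v \<in> V \<Longrightarrow> p v \<in> V \<Longrightarrow> orbit_class p V (p v) = orbit_class p V v"
  by (simp add: orbit_class_eq_iff orbit_rel_sym[OF orbit_rel_step])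

lemma orbit_count_eq_card_classes: "orbit_count p V = card (orbit_class p V ` V)"
proof -
  have "V // orbit_rel p V = orbit_class p V ` V"
    by (auto simp: quotient_def orbit_class_def)
  then show ?thesis by (simp add: orbit_count_def)
qed

text \<open>A labelling that is constant along steps and separates orbits has the same kernel as
  \<open>orbit_class\<close>, hence takes one value per orbit. The orbit counts below come from
  choosing a suitable \<open>r\<close>.\<close>

lemma orbit_count_eqI:
  assumes "\<And>v. v \<in> V \<Longrightarrow> r (p v) = r v"
    and "\<And>u v. u \<in> V \<Longrightarrow> v \<in> V \<Longrightarrow> r u = r v \<Longrightarrow> (u, v) \<in> orbit_rel p V"
  shows "orbit_count p V = card (r ` V)"
proof -
  have inv: "r u = r v" if "(u, v) \<in> orbit_rel p V" for u v
    by (rule orbit_rel_invariant[where p = p and V = V]) (use that assms(1) in auto)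
  show ?thesis
    unfolding orbit_count_eq_card_classes
  proof (rule card_image_cong_kernel)
    fix u v assume "u \<in> V" "v \<in> V"
    then show "orbit_class p V u = orbit_class p V v \<longleftrightarrow> r u = r v"
      unfolding orbit_class_eq_iff[OF \<open>u \<in> V\<close> \<open>v \<in> V\<close>] using inv assms(2) by blast
  qed
qed

lemma orbit_count_Un:
  assumes "finite V" "finite W" "V \<inter> W = {}" "p ` V \<subseteq> V" "p ` W \<subseteq> W"
  shows "orbit_count p (V \<union> W) = orbit_count p V + orbit_count p W"
proof -
  define r where "r = orbit_class p V"
  have r: "\<And>v. v \<in> V \<Longrightarrow> r (p v) = r v"
      "\<And>u v. u \<in> V \<Longrightarrow> v \<in> V \<Longrightarrow> r u = r v \<Longrightarrow> (u, v) \<in> orbit_rel p V"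
      "orbit_count p V = card (r ` V)"
    using assms(4) by (auto simp: r_def orbit_class_step orbit_class_eq_iff orbit_count_eq_card_classes image_subset_iff)
  define s where "s = orbit_class p W"
  have s: "\<And>v. v \<in> W \<Longrightarrow> s (p v) = s v"
      "\<And>u v. u \<in> W \<Longrightarrow> v \<in> W \<Longrightarrow> s u = s v \<Longrightarrow> (u, v) \<in> orbit_rel p W"
      "orbit_count p W = card (s ` W)"
    using assms(5) by (auto simp: s_def orbit_class_step orbit_class_eq_iff orbit_count_eq_card_classes image_subset_iff)
  have "(v, p v) \<in> orbit_rel p (V \<union> W)" if "v \<in> V \<union> W" for v
    using that assms(4,5) by (intro orbit_rel_step) auto
  then have sub: "orbit_rel p V \<subseteq> orbit_rel p (V \<union> W)" "orbit_rel p W \<subseteq> orbit_rel p (V \<union> W)"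
    by (simp_all add: orbit_rel_mono)
  \<comment> \<open>The tags \<open>Inl\<close> and \<open>Inr\<close> keep the labels of the two
    invariant sets apart.\<close>
  define t where "t = (\<lambda>v. if v \<in> V then Inl (r v) else Inr (s v))"
  have "orbit_count p (V \<union> W) = card (t ` (V \<union> W))"
  proof (rule orbit_count_eqI)
    show "t (p v) = t v" if "v \<in> V \<union> W" for v
      using that assms(3-5) by (auto simp: t_def r(1) s(1))
    show "(u, v) \<in> orbit_rel p (V \<union> W)" if "u \<in> V \<union> W" "v \<in> V \<union> W" "t u = t v" for u v
    proof (cases "u \<in> V")
      case True
      then have "v \<in> V" "r u = r v" using that(3) by (auto simp: t_def split: if_splits)
      then show ?thesis using True r(2) sub by blast
    next
      case False
      then have "u \<in> W" "v \<in> W" "s u = s v" using that by (auto simp: t_def split: if_splits)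
      then show ?thesis using s(2) sub by blast
    qed
  qed
  also have "t ` (V \<union> W) = Inl ` r ` V \<union> Inr ` s ` W"
    using assms(3) by (auto simp: t_def image_iff)
  also have "card \<dots> = card (r ` V) + card (s ` W)"
    using assms(1,2) by (subst card_Un_disjoint) (auto simp: card_image)
  finally show ?thesis by (simp add: r(3) s(3))
qed

text \<open>The new point is spliced into an existing orbit: \<open>y\<close>, \<open>q y\<close>
  becomes \<open>y\<close>, \<open>x\<close>, \<open>q y\<close>. That orbit gets longer, but no
  orbit is created or merged.\<close>

lemma orbit_count_insert:
  assumes "q ` V \<subseteq> V" "x \<notin> V" "y \<in> V" "p y = x" "p x = q y"
    and "\<And>v. v \<in> V \<Longrightarrow> v \<noteq> y \<Longrightarrow> p v = q v"
  shows "orbit_count p (insert x V) = orbit_count q V"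
proof -
  define r where "r = orbit_class q V"
  have r: "\<And>v. v \<in> V \<Longrightarrow> r (q v) = r v"
      "\<And>u v. u \<in> V \<Longrightarrow> v \<in> V \<Longrightarrow> r u = r v \<Longrightarrow> (u, v) \<in> orbit_rel q V"
      "orbit_count q V = card (r ` V)"
    using assms(1) by (auto simp: r_def orbit_class_step orbit_class_eq_iff orbit_count_eq_card_classes image_subset_iff)
  let ?R = "orbit_rel p (insert x V)"
  have yx: "(y, x) \<in> ?R"
    using orbit_rel_step[of y "insert x V" p] assms by auto
  have xq: "(x, q y) \<in> ?R"
    using orbit_rel_step[of x "insert x V" p] assms by auto
  have sub: "orbit_rel q V \<subseteq> ?R"
  proof (rule orbit_rel_mono)
    fix v assume "v \<in> V"
    then show "(v, q v) \<in> ?R"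
      using orbit_rel_step[of v "insert x V" p] orbit_rel_trans[OF yx xq] assms
      by (cases "v = y") auto
  qed auto
  \<comment> \<open>The inserted point inherits the label of its predecessor
    \<open>y\<close>.\<close>
  define t where "t = (\<lambda>v. r (if v = x then y else v))"
  have proj: "(v, if v = x then y else v) \<in> ?R" if "v \<in> insert x V" for v
    using that orbit_rel_refl[of v "insert x V" p] orbit_rel_sym[OF yx] by simp
  have "orbit_count p (insert x V) = card (t ` insert x V)"
  proof (rule orbit_count_eqI)
    show "t (p v) = t v" if "v \<in> insert x V" for v
    proof (cases "v = x \<or> v = y")
      case True
      then show ?thesis using assms r(1)[of y] by (auto simp: t_def)
    next
      case False
      then have "v \<in> V" "p v = q v" "q v \<in> V" using that assms by auto
      then show ?thesis using r(1)[of v] assms(2) by (auto simp: t_def)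
    qed
    fix u v assume uv: "u \<in> insert x V" "v \<in> insert x V" "t u = t v"
    let ?f = "\<lambda>v. if v = x then y else v"
    have "(?f u, ?f v) \<in> ?R"
      using uv r(2)[of "?f u" "?f v"] sub assms(3) unfolding t_def by (auto split: if_splits)
    then show "(u, v) \<in> ?R"
      using proj[OF uv(1)] proj[OF uv(2)] by (meson orbit_rel_sym orbit_rel_trans)
  qed
  moreover have "t ` V = r ` V"
    using assms(2) by (intro image_cong) (auto simp: t_def)
  then have "t ` insert x V = r ` V"
    using assms(3) by (simp add: t_def insert_absorb)
  ultimately show ?thesis by (simp add: r(3))
qed

lemma orbit_count_image:
  assumes "inj_on h V" "p ` V \<subseteq> V" "\<And>v. v \<in> V \<Longrightarrow> q (h v) = h (p v)"
  shows "orbit_count q (h ` V) = orbit_count p V"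
proof -
  define r where "r = orbit_class p V"
  have r: "\<And>v. v \<in> V \<Longrightarrow> r (p v) = r v"
      "\<And>u v. u \<in> V \<Longrightarrow> v \<in> V \<Longrightarrow> r u = r v \<Longrightarrow> (u, v) \<in> orbit_rel p V"
      "orbit_count p V = card (r ` V)"
    using assms(2) by (auto simp: r_def orbit_class_step orbit_class_eq_iff orbit_count_eq_card_classes image_subset_iff)
  have h: "(h u, h v) \<in> orbit_rel q (h ` V)" if "(u, v) \<in> orbit_rel p V" for u v
  proof -
    have "(u, v) \<in> {(a, b). a \<in> V \<and> b = p a \<or> b \<in> V \<and> a = p b}\<^sup>*" and "u \<in> V"
      using that by (auto simp: orbit_rel_def)
    then show ?thesis
    proof (induction rule: rtrancl_induct)
      case base
      then show ?case by (simp add: orbit_rel_refl)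
    next
      case (step y z)
      have st: "(h a, h (p a)) \<in> orbit_rel q (h ` V)" if "a \<in> V" for a
        using orbit_rel_step[of "h a" "h ` V" q] that assms(2,3) by force
      then have "(h y, h z) \<in> orbit_rel q (h ` V)"
        using step.hyps orbit_rel_sym[OF st] by auto
      then show ?case using step by (meson orbit_rel_trans)
    qed
  qed
  let ?t = "\<lambda>w. r (inv_into V h w)"
  have "orbit_count q (h ` V) = card (?t ` h ` V)"
  proof (rule orbit_count_eqI)
    show "?t (q w) = ?t w" if "w \<in> h ` V" for w
      using that r(1) assms by (auto simp: image_subset_iff)
    show "(u, w) \<in> orbit_rel q (h ` V)"
      if uw: "u \<in> h ` V" "w \<in> h ` V" "?t u = ?t w" for u w
    proof -
      obtain a b where "a \<in> V" "b \<in> V" "u = h a" "w = h b" using uw by auto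
      then show ?thesis using uw(3) h[OF r(2), of a b] assms(1) by simp
    qed
  qed
  also have "?t ` h ` V = r ` V"
    unfolding image_image using assms(1) by (intro image_cong) simp_all
  finally show ?thesis by (simp add: r(3))
qed

lemma orbit_count_1I:
  assumes "v \<in> V" "\<And>u. u \<in> V \<Longrightarrow> (v, u) \<in> orbit_rel p V"
  shows "orbit_count p V = 1"
proof -
  have "orbit_count p V = card ((\<lambda>_. 0::nat) ` V)"
  proof (rule orbit_count_eqI)
    show "(u, w) \<in> orbit_rel p V" if "u \<in> V" "w \<in> V" for u w
      using orbit_rel_trans[OF orbit_rel_sym[OF assms(2)[OF that(1)]] assms(2)[OF that(2)]] .
  qed simp
  moreover have "(\<lambda>_. 0::nat) ` V = {0}" using assms(1) by auto
  ultimately show ?thesis by simp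
qed

text \<open>For involutions, \<open>g \<circ> f\<close> undoes \<open>f \<circ> g\<close>, so each
  step of one map is a backward step of the other.\<close>

lemma orbit_rel_comp_swap_subset:
  assumes "f ` V \<subseteq> V" "g ` V \<subseteq> V"
    and "\<And>v. v \<in> V \<Longrightarrow> f (f v) = v" "\<And>v. v \<in> V \<Longrightarrow> g (g v) = v"
  shows "orbit_rel (f \<circ> g) V \<subseteq> orbit_rel (g \<circ> f) V"
proof (rule orbit_rel_mono)
  fix v assume v: "v \<in> V"
  then have "f (g v) \<in> V" "g v \<in> V" using assms(1,2) by auto
  then have "(f (g v), v) \<in> orbit_rel (g \<circ> f) V"
    using orbit_rel_step[of "f (g v)" V "g \<circ> f"] v assms by auto
  then show "(v, (f \<circ> g) v) \<in> orbit_rel (g \<circ> f) V"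
    using orbit_rel_sym by fastforce
qed simp

lemma orbit_rel_comp_swap:
  assumes "f ` V \<subseteq> V" "g ` V \<subseteq> V"
    and "\<And>v. v \<in> V \<Longrightarrow> f (f v) = v" "\<And>v. v \<in> V \<Longrightarrow> g (g v) = v"
  shows "orbit_rel (f \<circ> g) V = orbit_rel (g \<circ> f) V"
  using orbit_rel_comp_swap_subset[of f V g] orbit_rel_comp_swap_subset[of g V f] assms by blast

section \<open>The graph of two involutions\<close>

lemma orbit_count_Union:
  assumes "finite \<C>" "\<And>C. C \<in> \<C> \<Longrightarrow> finite C" "\<And>C. C \<in> \<C> \<Longrightarrow> p ` C \<subseteq> C"
    and "\<And>C D. C \<in> \<C> \<Longrightarrow> D \<in> \<C> \<Longrightarrow> C \<noteq> D \<Longrightarrow> C \<inter> D = {}"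
  shows "orbit_count p (\<Union>\<C>) = (\<Sum>C\<in>\<C>. orbit_count p C)"
  using assms
proof (induction \<C> rule: finite_induct)
  case empty
  show ?case by (simp add: orbit_count_def quotient_def)
next
  case (insert C \<C>)
  have "C \<inter> \<Union>\<C> = {}" using insert.prems(3)[of C] insert.hyps(2) by auto
  moreover have "p ` \<Union>\<C> \<subseteq> \<Union>\<C>" using insert.prems(2) by blast
  moreover have "finite (\<Union>\<C>)" using insert by auto
  ultimately have "orbit_count p (C \<union> \<Union>\<C>) = orbit_count p C + orbit_count p (\<Union>\<C>)"
    using insert.prems by (intro orbit_count_Un) auto
  with insert show ?case by simp
qed

text \<open>Both witnesses list \<open>C\<close> and its edges without repetition. A path has one
  vertex more than it has edges, a cycle equally many.\<close>

lemma not_path_and_cycle: "is_cycle E ends C \<Longrightarrow> \<not> is_path E ends C"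
  unfolding is_cycle_def is_path_def by (metis distinct_card n_not_Suc_n)

text \<open>The Boolean names the side, \<open>True\<close> for upper and \<open>False\<close> for
  lower, so that alternation of sides is negation. A fixed point of \<open>F b\<close> is a vertex
  without an edge on side \<open>b\<close>.\<close>

locale two_involutions =
  fixes V :: "'a set" and F :: "bool \<Rightarrow> 'a \<Rightarrow> 'a"
  assumes finite_V: "finite V"
    and F_closed: "v \<in> V \<Longrightarrow> F b v \<in> V"
    and F_F: "v \<in> V \<Longrightarrow> F b (F b v) = v"
begin

definition side_edges :: "bool \<Rightarrow> 'a set set" where
  "side_edges b = {{v, F b v} | v. v \<in> V \<and> F b v \<noteq> v}"

definition edges :: "('a set + 'a set) set" where
  "edges = side_edges True <+> side_edges False"

definition ends :: "'a set + 'a set \<Rightarrow> 'a set" where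
  "ends = case_sum (\<lambda>e. e) (\<lambda>e. e)"

definition edge :: "bool \<Rightarrow> 'a \<Rightarrow> 'a set + 'a set" where
  "edge b v = (if b then Inl {v, F b v} else Inr {v, F b v})"

lemma ends_edge [simp]: "ends (edge b v) = {v, F b v}"
  by (simp add: ends_def edge_def)

lemma edges_eq: "edges = {edge b v | b v. v \<in> V \<and> F b v \<noteq> v}" (is "_ = ?R")
proof (intro set_eqI iffI)
  fix e assume "e \<in> edges"
  then consider v where "v \<in> V" "F True v \<noteq> v" "e = edge True v"
    | v where "v \<in> V" "F False v \<noteq> v" "e = edge False v"
    by (auto simp: edges_def side_edges_def edge_def)
  then show "e \<in> ?R" by cases auto
next
  fix e assume "e \<in> ?R"
  then obtain b v where "v \<in> V" "F b v \<noteq> v" "e = edge b v" by auto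
  then show "e \<in> edges" by (cases b) (auto simp: edges_def side_edges_def edge_def)
qed

lemma edge_F: "v \<in> V \<Longrightarrow> edge b (F b v) = edge b v"
  by (simp add: edge_def F_F insert_commute)

lemma edge_eq_iff:
  assumes "u \<in> V" "v \<in> V"
  shows "edge b u = edge c v \<longleftrightarrow> b = c \<and> (u = v \<or> u = F b v)"
  using assms by (cases b; cases c) (auto simp: edge_def doubleton_eq_iff F_F)

section \<open>Walks along alternating sides\<close>

definition turn :: "bool \<Rightarrow> nat \<Rightarrow> bool" where
  "turn b k = (b \<noteq> odd k)"

text \<open>Even steps use side \<open>b\<close>, odd steps the other one. The walk stands still
  where the required edge is missing.\<close>

primrec walk :: "bool \<Rightarrow> 'a \<Rightarrow> nat \<Rightarrow> 'a" where
  "walk b v 0 = v"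
| "walk b v (Suc k) = F (turn b k) (walk b v k)"

lemma turn_Suc [simp]: "turn b (Suc k) \<longleftrightarrow> \<not> turn b k"
  by (auto simp: turn_def)

lemma turn_0 [simp]: "turn b 0 = b"
  by (simp add: turn_def)

lemma walk_in: "v \<in> V \<Longrightarrow> walk b v k \<in> V"
  by (induction k) (auto simp: F_closed)

lemma F_walk_Suc: "v \<in> V \<Longrightarrow> F (turn b k) (walk b v (Suc k)) = walk b v k"
  by (simp add: F_F walk_in)

text \<open>In a finite set the walk must meet an earlier vertex; the least such \<open>m\<close>
  has no repetition before it.\<close>

lemma walk_first_return:
  assumes v: "v \<in> V"
  obtains m where "inj_on (walk b v) {..m}" "walk b v (Suc m) \<in> walk b v ` {..m}"
proof -
  let ?P = "\<lambda>m. walk b v (Suc m) \<in> walk b v ` {..m}"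
  have distinct_upto: "inj_on (walk b v) {..m}" if "\<forall>k<m. \<not> ?P k" for m
  proof (rule linorder_inj_onI')
    fix i j assume ij: "i \<in> {..m}" "j \<in> {..m}" "i < j"
    then obtain k where k: "j = Suc k" "k < m" "i \<le> k" by (cases j) auto
    with that show "walk b v i \<noteq> walk b v j" by (metis atMost_iff image_eqI)
  qed
  have "\<exists>m. ?P m"
  proof (rule ccontr)
    assume "\<nexists>m. ?P m"
    then have "inj_on (walk b v) {..card V}" by (intro distinct_upto) blast
    moreover have "walk b v ` {..card V} \<subseteq> V" using walk_in[OF v] by auto
    ultimately have "card {..card V} \<le> card V" using finite_V card_inj_on_le by blast
    then show False by simp
  qed
  then obtain m where "?P m" "\<forall>k<m. \<not> ?P k" using exists_least_iff[of ?P] by blast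
  with distinct_upto show thesis using that by blast
qed

text \<open>A vertex strictly inside the walk already has its neighbours on both sides at the
  adjacent positions, so the walk cannot close up there. Closing up at the start must use the side
  that is still free at \<open>v\<close>, which forces \<open>m\<close> to be odd.\<close>

lemma walk_return_cases:
  assumes v: "v \<in> V" and inj: "inj_on (walk b v) {..m}"
    and ret: "walk b v (Suc m) \<in> walk b v ` {..m}"
  shows "walk b v (Suc m) = walk b v m \<or> walk b v (Suc m) = walk b v 0 \<and> odd m"
proof -
  let ?w = "walk b v"
  have eq: "?w i = ?w j \<Longrightarrow> i \<le> m \<Longrightarrow> j \<le> m \<Longrightarrow> i = j" for i j
    using inj by (auto simp: inj_on_def)
  obtain i where i: "i \<le> m" "?w (Suc m) = ?w i" using ret by auto
  have wm: "?w m = F (turn b m) (?w i)"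
    using F_walk_Suc[OF v, of b m] i(2) by simp
  show ?thesis
  proof (cases "i = m")
    case False
    then have im: "i < m" using i by simp
    have t: "turn b i \<noteq> turn b m"
    proof
      assume "turn b i = turn b m"
      then have "?w m = ?w (Suc i)" using wm by simp
      \<comment> \<open>Consecutive positions use opposite sides, against the assumption.\<close>
      then have "m = Suc i" using eq im by simp
      with \<open>turn b i = turn b m\<close> show False by simp
    qed
    have "i = 0"
    proof (rule ccontr)
      assume "i \<noteq> 0"
      then obtain j where j: "i = Suc j" by (cases i) auto
      then have "turn b m = turn b j" using t by simp
      then have "?w m = ?w j" using wm F_walk_Suc[OF v, of b j] j by simp
      then have "m = j" using eq[of m j] im j by simp
      then show False using im j by simp
    qed
    then have "odd m" using t by (auto simp: turn_def)
    then show ?thesis using i(2) \<open>i = 0\<close> by blast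
  qed (use i in simp)
qed

section \<open>Connected components and closed sets\<close>

lemma connected_step_iff:
  "(\<exists>e\<in>edges. ends e = {x, y}) \<longleftrightarrow> x \<in> V \<and> x \<noteq> y \<and> (\<exists>b. y = F b x)"
proof
  assume "\<exists>e\<in>edges. ends e = {x, y}"
  then obtain b v where bv: "v \<in> V" "F b v \<noteq> v" "{v, F b v} = {x, y}"
    by (auto simp: edges_eq)
  then consider "v = x" "F b v = y" | "v = y" "F b v = x"
    by (auto simp: doubleton_eq_iff)
  then show "x \<in> V \<and> x \<noteq> y \<and> (\<exists>b. y = F b x)"
  proof cases
    case 2
    then have "y = F b x" using F_F[OF bv(1), of b] by simp
    then show ?thesis using 2 bv F_closed[OF bv(1), of b] by auto
  qed (use bv in auto)
next
  assume "x \<in> V \<and> x \<noteq> y \<and> (\<exists>b. y = F b x)"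
  then obtain b where "x \<in> V" "F b x \<noteq> x" "y = F b x" by metis
  then have "edge b x \<in> edges" "ends (edge b x) = {x, y}" unfolding edges_eq by auto
  then show "\<exists>e\<in>edges. ends e = {x, y}" by blast
qed

definition joined :: "('a \<times> 'a) set" where
  "joined = {(x, y). x \<in> V \<and> x \<noteq> y \<and> (\<exists>b. y = F b x)}"

lemma connected_rel_eq: "connected_rel V edges ends = {(u, v) \<in> V \<times> V. (u, v) \<in> joined\<^sup>*}"
  by (simp add: connected_rel_def connected_step_iff joined_def)

lemma sym_joined: "sym joined"
proof (rule symI)
  fix x y assume "(x, y) \<in> joined"
  then obtain b where "x \<in> V" "x \<noteq> y" "y = F b x" by (auto simp: joined_def)
  then show "(y, x) \<in> joined" using F_F[of x b, symmetric] F_closed[of x b] unfolding joined_def by blast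
qed

lemma equiv_connected_rel: "equiv V (connected_rel V edges ends)"
  unfolding connected_rel_eq by (rule equiv_rtrancl_restrict[OF sym_joined])

lemma F_connected: "v \<in> V \<Longrightarrow> (v, F b v) \<in> connected_rel V edges ends"
  by (cases "F b v = v") (auto simp: connected_rel_eq joined_def F_closed)

lemma component_closed:
  assumes "C \<in> components V edges ends" "v \<in> C"
  shows "F b v \<in> C"
proof -
  have "v \<in> V" using assms in_quotient_imp_subset[OF equiv_connected_rel] 
    by (auto simp: components_def)
  then show ?thesis
    using assms in_quotient_imp_closed[OF equiv_connected_rel _ _ F_connected]
    unfolding components_def by blast
qed

text \<open>A set closed under both involutions cannot be left along edges, so it contains the
  component of \<open>v\<close>; connectedness to \<open>v\<close> gives the other
  inclusion.\<close>

lemma component_eqI: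
  assumes C: "C \<in> components V edges ends" and v: "v \<in> C" "v \<in> W" and W: "W \<subseteq> V"
    and closed: "\<And>w b. w \<in> W \<Longrightarrow> F b w \<in> W"
    and conn: "\<And>w. w \<in> W \<Longrightarrow> (v, w) \<in> connected_rel V edges ends"
  shows "C = W"
proof
  show "W \<subseteq> C"
    using C v conn in_quotient_imp_closed[OF equiv_connected_rel] unfolding components_def by blast
  show "C \<subseteq> W"
  proof
    fix u assume "u \<in> C"
    then have "(v, u) \<in> connected_rel V edges ends"
      using C v(1) quotient_eq_iff[OF equiv_connected_rel, of C C v u] 
      by (simp add: components_def)
    then have "(v, u) \<in> joined\<^sup>*" by (simp add: connected_rel_eq)
    then show "u \<in> W"
      by (induction rule: rtrancl_induct) (use v closed in \<open>auto simp: joined_def\<close>)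
  qed
qed

lemma comp_walk_even: "even k \<Longrightarrow> (F (\<not> b) \<circ> F b) (walk b v k) = walk b v (k + 2)"
  by (simp add: turn_def)

text \<open>An odd position is reached along side \<open>b\<close>, so the composite retraces two
  steps. It thus moves even positions forward and odd positions backward.\<close>

lemma comp_walk_odd:
  assumes "v \<in> V" "odd k"
  shows "(F (\<not> b) \<circ> F b) (walk b v (k + 2)) = walk b v k"
proof -
  have "F b (walk b v (Suc (Suc k))) = walk b v (Suc k)"
    using F_walk_Suc[OF assms(1), of b "Suc k"] assms(2) by (simp add: turn_def del: walk.simps)
  moreover have "F (\<not> b) (walk b v (Suc k)) = walk b v k"
    using F_walk_Suc[OF assms(1), of b k] assms(2) by (simp add: turn_def del: walk.simps)
  ultimately show ?thesis by (simp del: walk.simps)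
qed

text \<open>Moves by two positions link position \<open>k\<close> to position 0 or 1 without leaving
  the first \<open>m + 1\<close> positions.\<close>

lemma walk_parity_connected:
  assumes v: "v \<in> V"
  shows "k \<le> m \<Longrightarrow> (walk b v (k mod 2), walk b v k) \<in> orbit_rel (F (\<not> b) \<circ> F b) (walk b v ` {..m})"
proof (induction k rule: less_induct)
  case (less k)
  let ?R = "orbit_rel (F (\<not> b) \<circ> F b) (walk b v ` {..m})"
  show ?case
  proof (cases "k < 2")
    case True
    then have "k mod 2 = k" by simp
    then show ?thesis using less.prems by (simp add: orbit_rel_refl)
  next
    case False
    then obtain j where j: "k = j + 2" by (metis add.commute le_Suc_ex not_less)
    have in_W: "walk b v j \<in> walk b v ` {..m}" "walk b v k \<in> walk b v ` {..m}"
      using less.prems j by (simp_all del: walk.simps add_2_eq_Suc')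
    have "(walk b v j, walk b v k) \<in> ?R"
    proof (cases "even j")
      case True
      have "(F (\<not> b) \<circ> F b) (walk b v j) = walk b v k"
        unfolding j using True by (rule comp_walk_even)
      then show ?thesis using orbit_rel_step[OF in_W(1)] in_W(2) by metis
    next
      case False
      have "(F (\<not> b) \<circ> F b) (walk b v k) = walk b v j"
        unfolding j using v False by (rule comp_walk_odd)
      then show ?thesis using orbit_rel_step[OF in_W(2)] in_W(1) orbit_rel_sym by metis
    qed
    moreover have "(walk b v (k mod 2), walk b v j) \<in> ?R"
    proof -
      have "k mod 2 = j mod 2" "j < k" "j \<le> m" using less.prems j by simp_all
      then show ?thesis using less.IH[of j] by metis
    qed
    ultimately show ?thesis using orbit_rel_trans by metis
  qed
qed

lemma orbit_count_swap:
  assumes "C \<subseteq> V" "\<And>v b. v \<in> C \<Longrightarrow> F b v \<in> C"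
  shows "orbit_count (F (\<not> b) \<circ> F b) C = orbit_count (F True \<circ> F False) C"
proof (cases b)
  case True
  have "orbit_rel (F False \<circ> F True) C = orbit_rel (F True \<circ> F False) C"
    by (rule orbit_rel_comp_swap) (use assms F_F in auto)
  with True show ?thesis by (simp add: orbit_count_def)
qed simp

lemma walk_range_connected:
  assumes "v \<in> V"
  shows "(v, walk b v k) \<in> connected_rel V edges ends"
proof (induction k)
  case 0
  then show ?case using assms by (simp add: connected_rel_eq)
next
  case (Suc k)
  have "(walk b v k, walk b v (Suc k)) \<in> connected_rel V edges ends"
    using F_connected[OF walk_in[OF assms]] by simp
  with Suc show ?case using equiv_connected_rel by (metis equivE transD)
qed

text \<open>One side leads from position \<open>k\<close> to \<open>k + 1\<close>, the other to
  \<open>k - 1\<close>. Only the forward side at \<open>m\<close> and the backward side at 0 need an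
  argument: both are fixed on a path, and they are joined to each other on a cycle.\<close>

lemma walk_range_closed:
  assumes v: "v \<in> V"
    and ret: "walk b v (Suc m) = walk b v m \<and> F (\<not> b) v = v \<or> walk b v (Suc m) = v \<and> odd m"
    and k: "k \<le> m"
  shows "F c (walk b v k) \<in> walk b v ` {..m}"
proof (cases "c = turn b k")
  case True
  then have eq: "F c (walk b v k) = walk b v (Suc k)" by simp
  show ?thesis
  proof (cases "k = m")
    case True
    have "F c (walk b v k) = walk b v m \<or> F c (walk b v k) = walk b v 0"
      using ret eq True by auto
    then show ?thesis by (metis atMost_iff imageI le0 order_refl)
  next
    case False
    then show ?thesis using k unfolding eq by (intro imageI) simp
  qed
next
  case False
  show ?thesis
  proof (cases k)
    case 0
    then have "c = (\<not> b)" using False by auto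
    from ret show ?thesis
    proof
      assume "walk b v (Suc m) = walk b v m \<and> F (\<not> b) v = v"
      then have "F c (walk b v k) = walk b v 0" using 0 \<open>c = (\<not> b)\<close> by simp
      then show ?thesis by blast
    next
      assume m: "walk b v (Suc m) = v \<and> odd m"
      \<comment> \<open>Since \<open>m\<close> is odd, the closing step uses side
        \<open>\<not> b\<close>; undoing it leads from \<open>v\<close> back to position
        \<open>m\<close>.\<close>
      then have "F (turn b m) v = walk b v m"
        using F_walk_Suc[OF v, of b m] by (simp del: walk.simps)
      then have "F c (walk b v k) = walk b v m"
        using 0 \<open>c = (\<not> b)\<close> m by (auto simp: turn_def)
      then show ?thesis by blast
    qed
  next
    case (Suc j)
    then have "c = turn b j" using False by auto
    then have "F c (walk b v k) = walk b v j"
      using F_walk_Suc[OF v, of b j] Suc by simp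
    then show ?thesis using Suc k by auto
  qed
qed

lemma edges_within_eq:
  assumes "C \<subseteq> V" "\<And>v b. v \<in> C \<Longrightarrow> F b v \<in> C"
  shows "edges_within edges ends C = {edge b v | b v. v \<in> C \<and> F b v \<noteq> v}"
  using assms by (fastforce simp: edges_within_def edges_eq)

text \<open>Equal edge names mean the same side and equal or adjacent positions, and adjacent
  positions use opposite sides.\<close>

lemma walk_edges_inj:
  assumes v: "v \<in> V" and inj: "inj_on (walk b v) {..m}" and n: "n \<le> Suc m"
  shows "inj_on (\<lambda>k. edge (turn b k) (walk b v k)) {..<n}"
proof (rule linorder_inj_onI')
  fix i j assume ij: "i \<in> {..<n}" "j \<in> {..<n}" "i < j"
  show "edge (turn b i) (walk b v i) \<noteq> edge (turn b j) (walk b v j)"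
  proof
    assume "edge (turn b i) (walk b v i) = edge (turn b j) (walk b v j)"
    then have t: "turn b j = turn b i" and
      "walk b v j = walk b v i \<or> walk b v j = F (turn b i) (walk b v i)"
      using edge_eq_iff walk_in[OF v] by (metis, metis)
    then have "walk b v j = walk b v i \<or> walk b v j = walk b v (Suc i)" by simp
    then have "j = i \<or> j = Suc i"
    proof
      assume "walk b v j = walk b v i"
      then show ?thesis using inj ij n by (auto dest: inj_onD)
    next
      assume "walk b v j = walk b v (Suc i)"
      \<comment> \<open>From \<open>i < j\<close> and \<open>j \<le> m\<close> also
        \<open>Suc i\<close> stays within the range of injectivity.\<close>
      moreover have "Suc i \<in> {..m}" "j \<in> {..m}" using ij n by auto
      ultimately show ?thesis using inj_onD[OF inj] by metis
    qed
    then show False using t ij by auto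
  qed
qed

text \<open>The number \<open>n\<close> of edges is \<open>m\<close> on a path and
  \<open>m + 1\<close> on a cycle, where the closing edge counts too. The edge behind position
  \<open>k > 0\<close> is the edge ahead of \<open>k - 1\<close>, so listing the forward edges is
  enough.\<close>

lemma edges_within_walk:
  assumes v: "v \<in> V" and inj: "inj_on (walk b v) {..m}" and C: "C = walk b v ` {..m}"
    and ret: "walk b v (Suc m) = walk b v m \<and> F (\<not> b) v = v \<and> n = m
      \<or> walk b v (Suc m) = v \<and> odd m \<and> n = Suc m"
  shows "edges_within edges ends C = (\<lambda>k. edge (turn b k) (walk b v k)) ` {..<n}"
proof -
  have W: "C \<subseteq> V" "\<And>u c. u \<in> C \<Longrightarrow> F c u \<in> C"
    using walk_range_closed[OF v, of b m] ret walk_in[OF v] unfolding C by blast+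
  then have "edges_within edges ends C = {edge b v | b v. v \<in> C \<and> F b v \<noteq> v}"
    by (rule edges_within_eq)
  also have "\<dots> = (\<lambda>k. edge (turn b k) (walk b v k)) ` {..<n}"
  proof (intro equalityI subsetI)
    fix e assume "e \<in> {edge b v | b v. v \<in> C \<and> F b v \<noteq> v}"
    then obtain c k where e: "e = edge c (walk b v k)" "k \<le> m" "F c (walk b v k) \<noteq> walk b v k"
      unfolding C by auto
    show "e \<in> (\<lambda>k. edge (turn b k) (walk b v k)) ` {..<n}"
    proof (cases "c = turn b k")
      case True
      then have "k \<noteq> m" if "n = m" using e(3) ret that by auto
      then have "k < n" using e(2) ret by fastforce
      then show ?thesis using e(1) True by blast
    next
      case False
      show ?thesis
      proof (cases k)
        case 0
        then have c: "c = (\<not> b)" using False by auto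
        then have m: "walk b v (Suc m) = v" "odd m" "n = Suc m" using ret e(3) 0 by auto
        then have "turn b m = c" using c by (auto simp: turn_def)
        then have "edge c (walk b v k) = edge (turn b m) (walk b v m)"
          using edge_F[of "walk b v m" c, OF walk_in[OF v]] m(1) 0 by auto
        then show ?thesis using e(1) m(3) by blast
      next
        case (Suc j)
        then have "c = turn b j" using False by auto
        then have "e = edge (turn b j) (walk b v j)"
          using edge_F[of "walk b v j" c, OF walk_in[OF v]] e(1) Suc by simp
        moreover have "j < n" using e(2) Suc ret by auto
        ultimately show ?thesis by blast
      qed
    qed
  next
    fix e assume "e \<in> (\<lambda>k. edge (turn b k) (walk b v k)) ` {..<n}"
    then obtain k where k: "k < n" "e = edge (turn b k) (walk b v k)" by auto
    then have km: "k \<le> m" using ret by auto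
    \<comment> \<open>No listed edge is a loop. The case \<open>k = m\<close> arises only on a
      cycle, and there \<open>m\<close> is odd, so its closing edge joins two distinct
      vertices.\<close>
    have "walk b v (Suc k) \<noteq> walk b v k"
    proof (cases "k = m")
      case True
      then have "walk b v (Suc k) = walk b v 0" "odd m" using ret k by auto
      then show ?thesis using inj_onD[OF inj, of 0 m] True by auto
    next
      case False
      then show ?thesis using inj_onD[OF inj, of "Suc k" k] km by auto
    qed
    then show "e \<in> {edge b v | b v. v \<in> C \<and> F b v \<noteq> v}"
      using k km unfolding C by auto
  qed
  finally show ?thesis .
qed

section \<open>Paths, cycles and the orbits on them\<close>

lemma walk_is_path:
  assumes v: "v \<in> V" and inj: "inj_on (walk b v) {..m}"
    and ret: "walk b v (Suc m) = walk b v m" "F (\<not> b) v = v"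
  shows "is_path edges ends (walk b v ` {..m})"
  unfolding is_path_def
proof (intro exI conjI allI impI)
  let ?vs = "map (walk b v) [0..<Suc m]" and ?es = "map (\<lambda>k. edge (turn b k) (walk b v k)) [0..<m]"
  show "distinct ?vs" using inj by (simp add: distinct_map atLeast0_lessThan_Suc_eq_insert_0 lessThan_Suc_atMost atLeast0LessThan del: upt_Suc)
  show "set ?vs = walk b v ` {..m}" by (simp add: atLeast0LessThan lessThan_Suc_atMost del: upt_Suc)
  show "distinct ?es" using walk_edges_inj[OF v inj, of m] by (simp add: distinct_map atLeast0LessThan)
  show "set ?es = edges_within edges ends (walk b v ` {..m})"
    using edges_within_walk[OF v inj refl, of m] ret by (simp add: atLeast0LessThan)
  show "length ?vs = Suc (length ?es)" by simp
  show "ends (?es ! i) = {?vs ! i, ?vs ! Suc i}" if "i < length ?es" for i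
    using that by (simp add: nth_append del: upt_Suc)
qed

lemma walk_is_cycle:
  assumes v: "v \<in> V" and inj: "inj_on (walk b v) {..m}"
    and ret: "walk b v (Suc m) = v" "odd m"
  shows "is_cycle edges ends (walk b v ` {..m})"
  unfolding is_cycle_def
proof (intro exI conjI allI impI)
  let ?vs = "map (walk b v) [0..<Suc m]"
    and ?es = "map (\<lambda>k. edge (turn b k) (walk b v k)) [0..<Suc m]"
  show "distinct ?vs" using inj by (simp add: distinct_map atLeast0LessThan lessThan_Suc_atMost del: upt_Suc)
  show "set ?vs = walk b v ` {..m}" by (simp add: atLeast0LessThan lessThan_Suc_atMost del: upt_Suc)
  show "distinct ?es" using walk_edges_inj[OF v inj, of "Suc m"]
    by (simp add: distinct_map atLeast0LessThan del: upt_Suc)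
  show "set ?es = edges_within edges ends (walk b v ` {..m})"
    using edges_within_walk[OF v inj refl, of "Suc m"] ret by (simp add: atLeast0LessThan del: upt_Suc)
  show "length ?vs = length ?es" by simp
  have "m \<noteq> 0" using ret(2) by (intro notI) simp
  then show "2 \<le> length ?vs" by simp
  have nth: "?vs ! k = walk b v k" "?es ! k = edge (turn b k) (walk b v k)" if "k \<le> m" for k
    using that by (simp_all only: nth_map length_upt nth_upt less_Suc_eq_le add_0 diff_zero)
  show "ends (?es ! i) = {?vs ! i, ?vs ! (Suc i mod length ?vs)}" if "i < length ?es" for i
  proof -
    have im: "i \<le> m" using that by simp
    have "?vs ! (Suc i mod length ?vs) = walk b v (Suc i)"
    proof (cases "i = m")
      case True
      then have "Suc i mod length ?vs = 0" by simp
      then have "?vs ! (Suc i mod length ?vs) = walk b v 0" by (simp only: nth(1)[OF le0])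
      also have "\<dots> = walk b v (Suc i)" using ret(1) True by simp
      finally show ?thesis .
    next
      case False
      then have "Suc i mod length ?vs = Suc i" "Suc i \<le> m" using im by simp_all
      then show ?thesis by (simp only: nth(1))
    qed
    then show ?thesis unfolding nth[OF im] by (metis ends_edge walk.simps(2))
  qed
qed

text \<open>The missing edge at the start makes the composite turn round there: position 1 is sent
  to position 0. This connects the odd positions with the even ones.\<close>

lemma orbit_count_path:
  assumes v: "v \<in> V" and ret: "walk b v (Suc m) = walk b v m" "F (\<not> b) v = v"
  shows "orbit_count (F (\<not> b) \<circ> F b) (walk b v ` {..m}) = 1"
proof (rule orbit_count_1I)
  let ?R = "orbit_rel (F (\<not> b) \<circ> F b) (walk b v ` {..m})"
  show v_in: "v \<in> walk b v ` {..m}" by (rule image_eqI[of _ _ 0]) auto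
  have start: "(v, walk b v k) \<in> ?R" if "k \<le> m" "k < 2" for k
  proof (cases "k = 0")
    case True
    then show ?thesis using v_in by (simp add: orbit_rel_refl)
  next
    case False
    then have k: "k = 1" using that by simp
    have "(F (\<not> b) \<circ> F b) (walk b v k) = v"
      using k ret(2) F_F[OF v, of b] by simp
    then show ?thesis
      using orbit_rel_step[of "walk b v k" "walk b v ` {..m}" "F (\<not> b) \<circ> F b"] v_in that(1) orbit_rel_sym
      by (metis atMost_iff imageI)
  qed
  fix u assume "u \<in> walk b v ` {..m}"
  then obtain k where k: "k \<le> m" "u = walk b v k" by auto
  then have "(v, walk b v (k mod 2)) \<in> ?R"
    using start[of "k mod 2"] mod_less_eq_dividend[of k 2] by (simp del: mod_less_eq_dividend)
  then show "(v, u) \<in> ?R"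
    using walk_parity_connected[OF v k(1)] k(2) orbit_rel_trans by metis
qed

text \<open>The cycle has even length \<open>m + 1\<close>, so wrapping round preserves the parity
  of positions. The two parity classes are the two orbits.\<close>

lemma orbit_count_cycle:
  assumes v: "v \<in> V" and inj: "inj_on (walk b v) {..m}"
    and ret: "walk b v (Suc m) = v" "odd m"
  shows "orbit_count (F (\<not> b) \<circ> F b) (walk b v ` {..m}) = 2"
proof -
  let ?C = "walk b v ` {..m}" and ?p = "F (\<not> b) \<circ> F b"
  let ?R = "orbit_rel ?p ?C"
  \<comment> \<open>The label of a vertex is the parity of its position, which is well defined
    because the walk is injective up to \<open>m\<close>.\<close>
  define r where "r u = even (inv_into {..m} (walk b v) u)" for u
  have r: "r (walk b v k) = even k" if "k \<le> m" for k
    using that inj by (simp add: r_def)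
  have "orbit_count ?p ?C = card (r ` ?C)"
  proof (rule orbit_count_eqI)
    fix u assume "u \<in> ?C"
    then obtain k where k: "k \<le> m" "u = walk b v k" by auto
    show "r (?p u) = r u"
    proof (cases "even k")
      case True
      have pu: "?p u = walk b v (k + 2)" unfolding k(2) using True by (rule comp_walk_even)
      show ?thesis
      proof (cases "k + 2 \<le> m")
        case True
        then show ?thesis unfolding pu using r k by (simp del: add_2_eq_Suc' walk.simps)
      next
        case False
        have "k \<noteq> m" using \<open>even k\<close> ret(2) by auto
        \<comment> \<open>An even position that would leave the range is \<open>m - 1\<close>, and
          its image wraps to position 0.\<close>
        then have "k + 2 = Suc m" using False k(1) by simp
        then have "?p u = walk b v 0" using pu ret(1) by simp
        then show ?thesis using r[of 0] r[OF k(1)] k(2) \<open>even k\<close> by simp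
      qed
    next
      case False
      show ?thesis
      proof (cases "k = 1")
        case True
        have "F (turn b m) v = walk b v m"
          using F_walk_Suc[OF v, of b m] ret(1) by (simp del: walk.simps)
        \<comment> \<open>From position 1 side \<open>b\<close> leads to the start and the closing
          edge then leads to \<open>m\<close>, again an odd position.\<close>
        then have "?p u = walk b v m"
          using k(2) True F_F[OF v, of b] ret(2) by (simp add: turn_def)
        then show ?thesis using r[of m] r[OF k(1)] k(2) ret(2) False by simp
      next
        case k1: False
        have "2 \<le> k" using False k1 by presburger
        then obtain j where j: "k = j + 2" by (metis add.commute le_Suc_ex)
        then have "?p u = walk b v j" unfolding k(2) j using False v j by (intro comp_walk_odd) auto
        then show ?thesis using r[of j] r[OF k(1)] k j by simp
      qed
    qed
  next
    fix u w assume "u \<in> ?C" "w \<in> ?C" "r u = r w"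
    then obtain i j where ij: "i \<le> m" "j \<le> m" "u = walk b v i" "w = walk b v j" "even i = even j"
      using r by auto
    then have "i mod 2 = j mod 2" by presburger
    then show "(u, w) \<in> ?R"
      using walk_parity_connected[OF v ij(1)] walk_parity_connected[OF v ij(2)] ij(3,4)
        orbit_rel_sym orbit_rel_trans by metis
  qed
  also have "r ` ?C = {True, False}"
  proof -
    have "r (walk b v 0)" "\<not> r (walk b v m)" using r[of 0] r[of m] ret(2) by simp_all
    moreover have "walk b v 0 \<in> ?C" "walk b v m \<in> ?C" by blast+
    ultimately show ?thesis by (metis (full_types) UNIV_bool UNIV_eq_I image_eqI insert_commute)
  qed
  also have "card {True, False} = 2" by simp
  finally show ?thesis .
qed

text \<open>
  Start the alternating walk at an end of the component if there is one. It then stops at the other end;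
  otherwise it can only close up at its start, after an even number of steps.
\<close>

lemma component_dichotomy:
  assumes C: "C \<in> components V edges ends"
  shows "is_path edges ends C \<and> orbit_count (F True \<circ> F False) C = 1
    \<or> is_cycle edges ends C \<and> orbit_count (F True \<circ> F False) C = 2"
proof -
  have CV: "C \<subseteq> V"
    using C in_quotient_imp_subset[OF equiv_connected_rel] by (auto simp: components_def)
  \<comment> \<open>The conditional form of \<open>start\<close> covers both cases: as soon as any
    end exists in \<open>C\<close>, the chosen \<open>v\<close> is itself an end, with no edge on
    side \<open>\<not> b\<close>.\<close>
  obtain v b where vC: "v \<in> C" and start: "\<And>u c. u \<in> C \<Longrightarrow> F c u = u \<Longrightarrow> F (\<not> b) v = v"
  proof (cases "\<exists>u\<in>C. \<exists>c. F c u = u")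
    case True
    then obtain u c where "u \<in> C" "F (\<not> \<not> c) u = u" by auto
    then show thesis using that[of u "\<not> c"] by blast
  next
    case False
    have "C \<noteq> {}"
      using C in_quotient_imp_non_empty[OF equiv_connected_rel] by (simp add: components_def)
    then show thesis using False that by blast
  qed
  have v: "v \<in> V" using vC CV by auto
  obtain m where inj: "inj_on (walk b v) {..m}" and "walk b v (Suc m) \<in> walk b v ` {..m}"
    using walk_first_return[OF v] by blast
  note ret = walk_return_cases[OF v this]
  have closed: "\<And>u c. u \<in> C \<Longrightarrow> F c u \<in> C" by (rule component_closed[OF C])
  have walk_C: "walk b v k \<in> C" for k
    by (induction k) (use vC closed in auto)
  have path_or_cycle: "walk b v (Suc m) = walk b v m \<and> F (\<not> b) v = v \<or> walk b v (Suc m) = v \<and> odd m"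
  proof (cases "walk b v (Suc m) = walk b v m")
    case True
    \<comment> \<open>A walk that stands still has found a fixed point, so by the choice of
      \<open>v\<close> it started at an end.\<close>
    then have "F (\<not> b) v = v" using start[OF walk_C[of m], of "turn b m"] by simp
    then show ?thesis using True by blast
  next
    case False
    then show ?thesis using ret unfolding walk.simps(1) by blast
  qed
  have CW: "C = walk b v ` {..m}"
  proof (rule component_eqI[OF C vC])
    show "v \<in> walk b v ` {..m}" by (rule image_eqI[of _ _ 0]) auto
    show "walk b v ` {..m} \<subseteq> V" using walk_in[OF v] by blast
    show "F c w \<in> walk b v ` {..m}" if "w \<in> walk b v ` {..m}" for w c
      using that walk_range_closed[OF v path_or_cycle] by blast
    show "(v, w) \<in> connected_rel V edges ends" if "w \<in> walk b v ` {..m}" for w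
      using that walk_range_connected[OF v] by blast
  qed
  have swap: "orbit_count (F (\<not> b) \<circ> F b) C = orbit_count (F True \<circ> F False) C"
    using CV closed by (rule orbit_count_swap)
  from path_or_cycle show ?thesis
  proof
    assume "walk b v (Suc m) = walk b v m \<and> F (\<not> b) v = v"
    then show ?thesis
      using walk_is_path[OF v inj] orbit_count_path[OF v] swap unfolding CW by metis
  next
    assume "walk b v (Suc m) = v \<and> odd m"
    then show ?thesis
      using walk_is_cycle[OF v inj] orbit_count_cycle[OF v inj] swap unfolding CW by metis
  qed
qed

lemma index_eq_orbit_count:
  "2 * card {C \<in> components V edges ends. is_cycle edges ends C}
     + card {C \<in> components V edges ends. is_path edges ends C}
   = orbit_count (F True \<circ> F False) V"
proof -
  let ?K = "components V edges ends" and ?p = "F True \<circ> F False"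
  have sub: "C \<subseteq> V" if "C \<in> ?K" for C
    using that in_quotient_imp_subset[OF equiv_connected_rel] by (auto simp: components_def)
  have fin: "finite ?K"
    using finite_V sub by (meson finite_Pow_iff finite_subset Pow_iff subsetI)
  have "orbit_count ?p V = orbit_count ?p (\<Union>?K)"
    using Union_quotient[OF equiv_connected_rel] by (simp add: components_def)
  also have "\<dots> = (\<Sum>C\<in>?K. orbit_count ?p C)"
  proof (rule orbit_count_Union[OF fin])
    show "finite C" if "C \<in> ?K" for C using that sub finite_V finite_subset by blast
    show "?p ` C \<subseteq> C" if "C \<in> ?K" for C using component_closed[OF that] by auto
    show "C \<inter> D = {}" if "C \<in> ?K" "D \<in> ?K" "C \<noteq> D" for C D
      using that quotient_disj[OF equiv_connected_rel] unfolding components_def by blast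
  qed
  also have "\<dots> = (\<Sum>C\<in>?K. 2 * of_bool (is_cycle edges ends C) + of_bool (is_path edges ends C))"
    using component_dichotomy not_path_and_cycle by (intro sum.cong) fastforce+
  also have "\<dots> = 2 * card {C \<in> ?K. is_cycle edges ends C} + card {C \<in> ?K. is_path edges ends C}"
    using fin by (simp add: sum.distrib flip: sum_distrib_left) (simp add: of_bool_def sum.If_cases Int_def)
  finally show ?thesis by simp
qed

end

section \<open>Meanders and reflections\<close>

text \<open>Vertices count from 0 here. Beyond the total the map is the identity, so it is an
  involution on all of \<open>nat\<close>.\<close>

fun reflect :: "nat list \<Rightarrow> nat \<Rightarrow> nat" where
  "reflect [] i = i"
| "reflect (a # as) i = (if i < a then a - 1 - i else a + reflect as (i - a))"

lemma reflect_less: "i < sum_list as \<Longrightarrow> reflect as i < sum_list as"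
  by (induction as i rule: reflect.induct) auto

lemma reflect_reflect: "reflect as (reflect as i) = i"
  by (induction as i rule: reflect.induct) auto

lemma reflect_in_part:
  "j < length as \<Longrightarrow> r < as ! j \<Longrightarrow>
    reflect as (sum_list (take j as) + r) = sum_list (take j as) + (as ! j - 1 - r)"
proof (induction as arbitrary: j)
  case (Cons a as)
  then show ?case by (cases j) auto
qed simp

lemma in_part_less:
  fixes as :: "nat list"
  shows "j < length as \<Longrightarrow> r < as ! j \<Longrightarrow> sum_list (take j as) + r < sum_list as"
proof (induction as arbitrary: j)
  case (Cons a as)
  show ?case
  proof (cases j)
    case (Suc j')
    then show ?thesis using Cons.IH[of j'] Cons.prems by simp
  qed (use Cons.prems in simp)
qed simp

lemma in_some_part:
  fixes as :: "nat list"
  shows "i < sum_list as \<Longrightarrow> \<exists>j r. j < length as \<and> r < as ! j \<and> i = sum_list (take j as) + r"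
proof (induction as arbitrary: i)
  case (Cons a as)
  show ?case
  proof (cases "i < a")
    case True
    then show ?thesis by (intro exI[of _ 0] exI[of _ i]) simp
  next
    case False
    then have "i - a < sum_list as" using Cons.prems by simp
    then obtain j r where "j < length as" "r < as ! j" "i - a = sum_list (take j as) + r"
      using Cons.IH[of "i - a"] by blast
    with False show ?thesis by (intro exI[of _ "Suc j"] exI[of _ r]) simp
  qed
qed simp

text \<open>Arcs are the two-element orbits of the reflection; the middle of an odd part is fixed
  and carries no arc. \<open>Suc\<close> passes to the numbering from 1.\<close>

lemma arcs_eq:
  "arcs as = {{Suc i, Suc (reflect as i)} | i. i < sum_list as \<and> reflect as i \<noteq> i}" (is "_ = ?R")
proof (intro equalityI subsetI)
  fix e assume "e \<in> arcs as"
  then obtain j i where j: "j < length as" and i: "1 \<le> i" "i \<le> as ! j div 2"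
    and e: "e = {sum_list (take j as) + i, sum_list (take j as) + as ! j + 1 - i}"
    unfolding arcs_def by blast
  let ?k = "sum_list (take j as) + (i - 1)"
  have lt: "i - 1 < as ! j" using i by linarith
  have eq: "reflect as ?k = sum_list (take j as) + (as ! j - 1 - (i - 1))"
    using j lt by (rule reflect_in_part)
  have "?k < sum_list as" using j lt by (rule in_part_less)
  moreover have "reflect as ?k \<noteq> ?k" unfolding eq using i by linarith
  moreover have "Suc ?k = sum_list (take j as) + i" using i by simp
  moreover have "Suc (reflect as ?k) = sum_list (take j as) + as ! j + 1 - i"
    unfolding eq using i by linarith
  ultimately have "e = {Suc ?k, Suc (reflect as ?k)} \<and> ?k < sum_list as \<and> reflect as ?k \<noteq> ?k"
    unfolding e by metis
  then show "e \<in> ?R" by blast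
next
  fix e assume "e \<in> ?R"
  then obtain k where k: "k < sum_list as" "reflect as k \<noteq> k" "e = {Suc k, Suc (reflect as k)}"
    by blast
  obtain j r where j: "j < length as" and r: "r < as ! j" and kr: "k = sum_list (take j as) + r"
    using in_some_part[OF k(1)] by blast
  have eq: "reflect as k = sum_list (take j as) + (as ! j - 1 - r)"
    unfolding kr using j r by (rule reflect_in_part)
  have ne: "r \<noteq> as ! j - 1 - r" using k(2) eq kr by simp
  \<comment> \<open>An arc is indexed by its left end, so the smaller of the two positions is taken,
    counted from 1.\<close>
  let ?i = "if r < as ! j - 1 - r then r + 1 else as ! j - r"
  have i: "1 \<le> ?i" "?i \<le> as ! j div 2" using r ne by auto
  have "Suc k = sum_list (take j as) + (r + 1)" "Suc (reflect as k) = sum_list (take j as) + (as ! j - r)"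
    using kr eq r by simp_all
  then have "e = {sum_list (take j as) + (r + 1), sum_list (take j as) + (as ! j - r)}"
    unfolding k(3) by simp
  moreover have "sum_list (take j as) + as ! j + 1 - (r + 1) = sum_list (take j as) + (as ! j - r)"
      "sum_list (take j as) + as ! j + 1 - (as ! j - r) = sum_list (take j as) + (r + 1)"
    using r by linarith+
  ultimately have "e = {sum_list (take j as) + ?i, sum_list (take j as) + as ! j + 1 - ?i}"
    by (simp only: insert_commute split: if_split) simp
  then show "e \<in> arcs as" unfolding arcs_def using i j by blast
qed

definition ind :: "nat list \<Rightarrow> nat list \<Rightarrow> nat" where
  "ind l m = orbit_count (reflect l \<circ> reflect m) {..<sum_list l}"

text \<open>The two reflections, shifted by one, are a pair of involutions of \<open>{1..n}\<close>
  whose graph is the meander. Conjugation by \<open>Suc\<close> brings the orbit count back to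
  \<open>{..<n}\<close>.\<close>

lemma meander_index_eq_ind:
  assumes "sum_list l = sum_list m"
  shows "meander_index l m = ind l m"
proof -
  define n where "n = sum_list l"
  define F where "F b v = Suc (reflect (if b then l else m) (v - 1))" for b v
  have lt: "reflect (if b then l else m) i < n" if "i < n" for b i
    using that reflect_less[of i l] reflect_less[of i m] assms by (simp add: n_def)
  have sum: "sum_list (if b then l else m) = n" for b
    using assms by (simp add: n_def)
  interpret two_involutions "{1..n}" F
  proof
    show "F b v \<in> {1..n}" if "v \<in> {1..n}" for b v
    proof -
      have "v - 1 < n" using that by auto
      then show ?thesis using lt[of "v - 1" b] by (simp add: F_def Suc_le_eq)
    qed
    show "F b (F b v) = v" if "v \<in> {1..n}" for b v
      using that by (simp add: F_def reflect_reflect)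
  qed simp
  have side: "side_edges b = arcs (if b then l else m)" for b
  proof (intro equalityI subsetI)
    fix e assume "e \<in> side_edges b"
    then obtain v where "v \<in> {1..n}" "F b v \<noteq> v" "e = {v, F b v}"
      unfolding side_edges_def by blast
    then show "e \<in> arcs (if b then l else m)"
      unfolding arcs_eq sum by (intro CollectI exI[of _ "v - 1"]) (auto simp: F_def)
  next
    fix e assume "e \<in> arcs (if b then l else m)"
    then obtain i where "i < n" "reflect (if b then l else m) i \<noteq> i"
        "e = {Suc i, Suc (reflect (if b then l else m) i)}"
      unfolding arcs_eq sum by blast
    then show "e \<in> side_edges b"
      unfolding side_edges_def by (intro CollectI exI[of _ "Suc i"]) (auto simp: F_def)
  qed
  have edges: "edges = meander_edges l m"
    by (simp only: edges_def meander_edges_def side if_True if_False)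
  have ends: "ends = meander_ends"
    by (simp only: ends_def meander_ends_def)
  have "meander_index l m = orbit_count (F True \<circ> F False) {1..n}"
    using index_eq_orbit_count
    by (simp only: meander_index_def meander_components_def edges ends n_def[symmetric])
  also have "{1..n} = Suc ` {..<n}"
    by (simp add: image_Suc_lessThan)
  also have "orbit_count (F True \<circ> F False) (Suc ` {..<n}) = orbit_count (reflect l \<circ> reflect m) {..<n}"
    by (rule orbit_count_image) (use lt[of _ True] lt[of _ False] in \<open>auto simp: F_def\<close>)
  finally show ?thesis by (simp add: ind_def n_def)
qed

lemma ind_swap:
  assumes "sum_list l = sum_list m"
  shows "ind m l = ind l m"
proof -
  have "orbit_rel (reflect m \<circ> reflect l) {..<sum_list l} = orbit_rel (reflect l \<circ> reflect m) {..<sum_list l}"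
    using reflect_less[of _ l] reflect_less[of _ m] assms
    by (intro orbit_rel_comp_swap) (auto simp: reflect_reflect)
  then show ?thesis by (simp add: ind_def orbit_count_def assms)
qed

lemma ind_Nil: "ind [] [] = 0"
  by (simp add: ind_def orbit_count_def quotient_def)

section \<open>Removal of leading parts\<close>

lemma add_image_lessThan_iff: "v \<in> (+) k ` {..<n} \<longleftrightarrow> k \<le> v \<and> v < k + n" for v k n :: nat
  by (auto simp: image_iff intro!: bexI[of _ "v - k"])

lemma orbit_count_drop:
  fixes p q :: "nat \<Rightarrow> nat"
  assumes "p ` {..<k} \<subseteq> {..<k}" "q ` {..<n} \<subseteq> {..<n}"
    and "\<And>i. i < n \<Longrightarrow> p (k + i) = k + q i"
  shows "orbit_count p {..<k + n} = orbit_count p {..<k} + orbit_count q {..<n}"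
proof -
  have img: "orbit_count p ((+) k ` {..<n}) = orbit_count q {..<n}"
    by (rule orbit_count_image) (use assms(2,3) in \<open>auto simp: inj_on_def\<close>)
  have split: "{..<k + n} = {..<k} \<union> (+) k ` {..<n}"
    by (auto simp: add_image_lessThan_iff simp del: image_add_0)
  have "orbit_count p ({..<k} \<union> (+) k ` {..<n}) = orbit_count p {..<k} + orbit_count p ((+) k ` {..<n})"
    using assms by (intro orbit_count_Un) auto
  then show ?thesis using img split by simp
qed

lemma comp_reflect_closed:
  "sum_list l = n \<Longrightarrow> sum_list m = n \<Longrightarrow> (reflect l \<circ> reflect m) ` {..<n} \<subseteq> {..<n}"
  using reflect_less[of _ l] reflect_less[of _ m] by auto

lemma orbit_count_fixed:
  assumes "\<And>v. v \<in> V \<Longrightarrow> p v = v"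
  shows "orbit_count p V = card V"
proof -
  have "orbit_count p V = card (id ` V)"
    by (rule orbit_count_eqI) (auto simp: assms intro: orbit_rel_refl)
  then show ?thesis by simp
qed

text \<open>On a common first part the two reflections cancel, which gives \<open>a\<close> fixed
  points.\<close>

lemma ind_Cons_same:
  assumes "sum_list l = sum_list m"
  shows "ind (a # l) (a # m) = a + ind l m"
proof -
  have "orbit_count (reflect (a # l) \<circ> reflect (a # m)) {..<a} = a"
    by (subst orbit_count_fixed) auto
  moreover have "orbit_count (reflect (a # l) \<circ> reflect (a # m)) {..<a + sum_list l}
    = orbit_count (reflect (a # l) \<circ> reflect (a # m)) {..<a} + ind l m"
    unfolding ind_def using comp_reflect_closed[OF refl assms[symmetric]]
    by (intro orbit_count_drop) auto
  ultimately show ?thesis by (simp add: ind_def)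
qed

lemma lessThan_3: "{..<3::nat} = {0, 1, 2}"
  by auto

text \<open>The lower reflection is trivial on the first three vertices, so the orbits there are
  those of the upper one: \<open>{0, 2}\<close> and \<open>{1}\<close>.\<close>

lemma ind_3_111:
  assumes "sum_list l = sum_list m"
  shows "ind (3 # l) (1 # 1 # 1 # m) = 2 + ind l m"
proof -
  let ?p = "reflect (3 # l) \<circ> reflect (1 # 1 # 1 # m)"
  have p: "?p 0 = 2" "?p 2 = 0" "?p 1 = 1" by simp_all
  have "orbit_count ?p {..<3} = 2"
  proof -
    have "orbit_count ?p ({0, 2} \<union> {1}) = orbit_count ?p {0, 2} + orbit_count ?p {1}"
      by (rule orbit_count_Un) (use p in auto)
    also have "orbit_count ?p {0, 2} = 1"
    proof (rule orbit_count_1I[of 0])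
      show "(0, u) \<in> orbit_rel ?p {0, 2}" if "u \<in> {0, 2}" for u
        using that orbit_rel_refl[of 0 "{0, 2}" ?p] orbit_rel_step[of 0 "{0, 2}" ?p] p by auto
    qed simp
    also have "orbit_count ?p {1} = 1"
      by (rule orbit_count_1I[of 1]) (auto intro: orbit_rel_refl)
    also have "{0, 2} \<union> {1} = {..<3::nat}" by auto
    also have "1 + 1 = (2::nat)" by simp
    finally show ?thesis .
  qed
  moreover have "orbit_count ?p {..<3 + sum_list l} = orbit_count ?p {..<3} + ind l m"
    unfolding ind_def using comp_reflect_closed[OF refl assms[symmetric]] p
    by (intro orbit_count_drop) (auto simp: lessThan_3)
  ultimately show ?thesis by (simp add: ind_def)
qed

text \<open>Vertices 0 and 2 form one orbit. Vertex 1 sits between 3 and the image of 3 in the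
  smaller meander, where 3 has become a lower part of size 1.\<close>

lemma ind_3_13:
  assumes "sum_list l = Suc (sum_list m)"
  shows "ind (3 # l) (1 # 3 # m) = 1 + ind l (1 # m)"
proof -
  define f where "f = reflect (3 # l) \<circ> reflect (1 # 3 # m)"
  let ?q = "reflect l \<circ> reflect (1 # m)"
  let ?n = "sum_list l"
  \<comment> \<open>The remaining meander keeps its place behind the removed part 3, so that
    \<open>q\<close> and \<open>f\<close> agree on \<open>W\<close> except at 3.\<close>
  define q where "q v = 3 + ?q (v - 3)" for v
  have q_closed: "?q ` {..<?n} \<subseteq> {..<?n}"
    by (rule comp_reflect_closed) (use assms in auto)
  define W where "W = (+) 3 ` {..<?n}"
  have W_iff: "v \<in> W \<longleftrightarrow> 3 \<le> v \<and> v < 3 + ?n" for v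
    unfolding W_def by (rule add_image_lessThan_iff)
  have "q ` W = (+) 3 ` ?q ` {..<?n}" unfolding W_def q_def image_image by simp
  then have q_W: "q ` W \<subseteq> W" unfolding W_def using image_mono[OF q_closed, of "(+) 3"] by argo
  have W: "{..<3 + ?n} = {0, 2} \<union> insert 1 W" by (auto simp: W_iff)
  have p: "f 0 = 2" "f 2 = 0" "f 3 = 1" "f 1 = q 3" by (simp_all add: f_def q_def)
  have pq: "f v = q v" if "v \<in> W" "v \<noteq> 3" for v
    using that by (auto simp: W_iff f_def q_def)
  have three: "3 \<in> W" using assms by (simp add: W_iff)
  have "orbit_count f ({0, 2} \<union> insert 1 W) = orbit_count f {0, 2} + orbit_count f (insert 1 W)"
  proof (rule orbit_count_Un)
    show "f ` insert 1 W \<subseteq> insert 1 W"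
    proof
      fix w assume "w \<in> f ` insert 1 W"
      then obtain v where "v \<in> insert 1 W" "w = f v" by auto
      then show "w \<in> insert 1 W" using p pq[of v] q_W three by (cases "v = 1 \<or> v = 3") auto
    qed
    show "f ` {0, 2} \<subseteq> {0, 2}" using p by auto
  qed (auto simp: W_iff W_def)
  also have "orbit_count f {0, 2} = 1"
  proof (rule orbit_count_1I[of 0])
    show "(0, u) \<in> orbit_rel f {0, 2}" if "u \<in> {0, 2}" for u
      using that orbit_rel_refl[of 0 "{0, 2}" f] orbit_rel_step[of 0 "{0, 2}" f] p by auto
  qed simp
  also have "orbit_count f (insert 1 W) = orbit_count q W"
    by (rule orbit_count_insert[OF q_W _ three]) (use p pq in \<open>auto simp: W_iff\<close>)
  also have "\<dots> = orbit_count ?q {..<?n}"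
    unfolding W_def by (rule orbit_count_image) (use q_closed in \<open>auto simp: q_def inj_on_def\<close>)
  finally show ?thesis unfolding W[symmetric] ind_def f_def sum_list.Cons .
qed

text \<open>Vertex 1 is fixed, and 4, 0, 2 follow one another in an orbit that goes on as vertex 4
  does in the smaller meander. Two removals of a point, first 0 and then 2, give the
  reduction.\<close>

lemma ind_3_113:
  assumes "sum_list l = 2 + sum_list m"
  shows "ind (3 # l) (1 # 1 # 3 # m) = 1 + ind l (1 # 1 # m)"
proof -
  define f where "f = reflect (3 # l) \<circ> reflect (1 # 1 # 3 # m)"
  let ?q = "reflect l \<circ> reflect (1 # 1 # m)"
  let ?n = "sum_list l"
  define q where "q v = 3 + ?q (v - 3)" for v
  \<comment> \<open>This is the intermediate permutation, with only vertex 2 spliced in between 4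
    and \<open>q 4\<close>.\<close>
  define q' where "q' v = (if v = 4 then 2 else if v = 2 then q 4 else q v)" for v
  have q_closed: "?q ` {..<?n} \<subseteq> {..<?n}"
    by (rule comp_reflect_closed) (use assms in auto)
  define W where "W = (+) 3 ` {..<?n}"
  have W_iff: "v \<in> W \<longleftrightarrow> 3 \<le> v \<and> v < 3 + ?n" for v
    unfolding W_def by (rule add_image_lessThan_iff)
  have "q ` W = (+) 3 ` ?q ` {..<?n}" unfolding W_def q_def image_image by simp
  then have q_W: "q ` W \<subseteq> W" unfolding W_def using image_mono[OF q_closed, of "(+) 3"] by argo
  have four: "4 \<in> W" using assms by (simp add: W_iff)
  have q'_W: "q' ` insert 2 W \<subseteq> insert 2 W" using q_W four by (auto simp: q'_def)
  have W: "{..<3 + ?n} = {1} \<union> insert 0 (insert 2 W)" by (auto simp: W_iff)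
  have p: "f 1 = 1" "f 0 = 2" "f 2 = q 4" "f 4 = 0" by (simp_all add: f_def q_def)
  have pq: "f v = q v" if "v \<in> W" "v \<noteq> 4" for v
    using that by (auto simp: W_iff f_def q_def)
  have "orbit_count f ({1} \<union> insert 0 (insert 2 W))
    = orbit_count f {1} + orbit_count f (insert 0 (insert 2 W))"
  proof (rule orbit_count_Un)
    show "f ` insert 0 (insert 2 W) \<subseteq> insert 0 (insert 2 W)"
    proof
      fix w assume "w \<in> f ` insert 0 (insert 2 W)"
      then obtain v where "v \<in> insert 0 (insert 2 W)" "w = f v" by auto
      then show "w \<in> insert 0 (insert 2 W)"
        using p pq[of v] q_W four by (cases "v = 0 \<or> v = 2 \<or> v = 4") auto
    qed
    show "f ` {1} \<subseteq> {1}" using p by auto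
  qed (auto simp: W_iff W_def)
  also have "orbit_count f {1} = 1"
    by (rule orbit_count_1I[of 1]) (auto intro: orbit_rel_refl)
  also have "orbit_count f (insert 0 (insert 2 W)) = orbit_count q' (insert 2 W)"
    by (rule orbit_count_insert[OF q'_W, where y = 4]) (use p pq four in \<open>auto simp: W_iff q'_def\<close>)
  also have "orbit_count q' (insert 2 W) = orbit_count q W"
    by (rule orbit_count_insert[OF q_W _ four]) (auto simp: W_iff q'_def)
  also have "\<dots> = orbit_count ?q {..<?n}"
    unfolding W_def by (rule orbit_count_image) (use q_closed in \<open>auto simp: q_def inj_on_def\<close>)
  finally show ?thesis unfolding W[symmetric] ind_def f_def sum_list.Cons .
qed

section \<open>Generating functions\<close>

definition pairs :: "nat set \<Rightarrow> (nat list \<times> nat list) set" where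
  "pairs J = {(l, m). set l \<subseteq> J \<and> set m \<subseteq> J \<and> sum_list l = sum_list m}"

definition level :: "(nat list \<times> nat list) set \<Rightarrow> nat \<Rightarrow> (nat list \<times> nat list) set" where
  "level P n = {z \<in> P. sum_list (fst z) = n}"

text \<open>The series is meant for sets with finite levels; a sum over an infinite level has the
  default value 0.\<close>

definition pair_gf :: "(nat list \<times> nat list) set \<Rightarrow> rat fps fps" where
  "pair_gf P = Abs_fps (\<lambda>n. \<Sum>z\<in>level P n. fps_X ^ ind (fst z) (snd z))"

lemma length_le_sum_list: "0 \<notin> set (l :: nat list) \<Longrightarrow> length l \<le> sum_list l"
  by (induction l) (auto simp: Suc_le_eq)

text \<open>Positive parts bound the length of a composition by its sum, and there are finitely many
  lists of bounded length over \<open>J\<close>.\<close>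

lemma finite_level:
  assumes "finite J" "0 \<notin> J" "P \<subseteq> pairs J"
  shows "finite (level P n)"
proof (rule finite_subset)
  let ?L = "{l. set l \<subseteq> J \<and> length l \<le> n}"
  show "level P n \<subseteq> ?L \<times> ?L"
    using assms(2,3) length_le_sum_list unfolding level_def pairs_def by fastforce
  show "finite (?L \<times> ?L)"
    using finite_lists_length_le[OF assms(1)] by blast
qed

lemma pair_gf_Un:
  assumes "finite J" "0 \<notin> J" "P \<union> Q \<subseteq> pairs J" "P \<inter> Q = {}"
  shows "pair_gf (P \<union> Q) = pair_gf P + pair_gf Q"
proof (rule fps_ext)
  fix n
  have "level (P \<union> Q) n = level P n \<union> level Q n" "level P n \<inter> level Q n = {}"
    using assms(4) by (auto simp: level_def)
  moreover have "finite (level P n)" "finite (level Q n)"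
    using assms by (auto intro!: finite_level[of J])
  ultimately show "pair_gf (P \<union> Q) $ n = (pair_gf P + pair_gf Q) $ n"
    by (simp add: pair_gf_def sum.union_disjoint)
qed

text \<open>This turns a size-and-index reduction of meanders into a monomial factor; each
  recurrence below uses it.\<close>

lemma pair_gf_image:
  assumes "inj_on h P"
    and "\<And>z. z \<in> P \<Longrightarrow> sum_list (fst (h z)) = a + sum_list (fst z)"
    and "\<And>z. z \<in> P \<Longrightarrow> ind (fst (h z)) (snd (h z)) = b + ind (fst z) (snd z)"
  shows "pair_gf (h ` P) = var_x ^ a * var_y ^ b * pair_gf P"
proof (rule fps_ext)
  fix n
  have y: "var_y ^ b = fps_const (fps_X ^ b)" by (simp add: fps_const_power)
  show "pair_gf (h ` P) $ n = (var_x ^ a * var_y ^ b * pair_gf P) $ n"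
  proof (cases "n < a")
    case True
    then have "sum_list (fst (h z)) \<noteq> n" if "z \<in> P" for z
      using assms(2)[OF that] by linarith
    then have "level (h ` P) n = {}" unfolding level_def by blast
    with True show ?thesis by (simp add: pair_gf_def mult.assoc fps_X_power_mult_nth)
  next
    case False
    have "sum_list (fst (h z)) = n \<longleftrightarrow> sum_list (fst z) = n - a" if "z \<in> P" for z
      using False assms(2)[OF that] by linarith
    then have lev: "level (h ` P) n = h ` level P (n - a)"
      unfolding level_def by blast
    have inj: "inj_on h (level P (n - a))"
      using assms(1) by (rule inj_on_subset) (auto simp: level_def)
    have "(\<Sum>z\<in>level (h ` P) n. fps_X ^ ind (fst z) (snd z))
      = (\<Sum>z\<in>level P (n - a). fps_X ^ b * (fps_X ^ ind (fst z) (snd z) :: rat fps))"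
      unfolding lev sum.reindex[OF inj] using assms(3)
      by (intro sum.cong) (auto simp: level_def power_add)
    with False show ?thesis
      by (simp add: pair_gf_def mult.assoc fps_X_power_mult_nth y sum_distrib_left)
  qed
qed

lemma meander_gf_eq_pair_gf:
  assumes "finite J" "0 \<notin> J"
  shows "meander_gf J = pair_gf (pairs J)"
proof (rule fps_ext, rule fps_ext)
  fix n k
  have lev: "{(l, m). composition n l \<and> composition n m \<and> set l \<subseteq> J \<and> set m \<subseteq> J \<and> meander_index l m = k}
    = {z \<in> level (pairs J) n. ind (fst z) (snd z) = k}"
  proof -
    \<comment> \<open>Positivity of the parts, demanded by \<open>composition\<close>, follows from
      \<open>0 \<notin> J\<close>.\<close>
    have pos: "\<forall>a\<in>set l. 0 < a" if "set l \<subseteq> J" for l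
      using that assms(2) by (metis gr0I subsetD)
    show ?thesis
      using pos by (auto simp: level_def pairs_def composition_def meander_index_eq_ind)
  qed
  have "finite (level (pairs J) n)" using assms by (intro finite_level) auto
  then have "pair_gf (pairs J) $ n $ k = of_nat (card {z \<in> level (pairs J) n. ind (fst z) (snd z) = k})"
    by (simp add: pair_gf_def fps_sum_nth sum.If_cases Int_def eq_commute conj_commute)
  then show "meander_gf J $ n $ k = pair_gf (pairs J) $ n $ k"
    by (simp add: meander_gf_def meander_count_def lev)
qed

section \<open>Recurrences for parts 1 and 3\<close>

abbreviation pairs13 :: "(nat list \<times> nat list) set" where
  "pairs13 \<equiv> pairs {1, 3}"

text \<open>In this name and the next three, the final digits are the prescribed beginning of the
  lower composition, and a 3 before an underscore that of the upper one.\<close>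

definition pairs1 :: "(nat list \<times> nat list) set" where
  "pairs1 = {(l, m) \<in> pairs13. \<exists>m'. m = 1 # m'}"

definition pairs11 :: "(nat list \<times> nat list) set" where
  "pairs11 = {(l, m) \<in> pairs13. \<exists>m'. m = 1 # 1 # m'}"

definition pairs3_1 :: "(nat list \<times> nat list) set" where
  "pairs3_1 = {(l, m) \<in> pairs13. \<exists>l' m'. l = 3 # l' \<and> m = 1 # m'}"

definition pairs3_11 :: "(nat list \<times> nat list) set" where
  "pairs3_11 = {(l, m) \<in> pairs13. \<exists>l' m'. l = 3 # l' \<and> m = 1 # 1 # m'}"

lemma pair_gf_Un13:
  "P \<union> Q \<subseteq> pairs13 \<Longrightarrow> P \<inter> Q = {} \<Longrightarrow> pair_gf (P \<union> Q) = pair_gf P + pair_gf Q"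
  by (rule pair_gf_Un[of "{1, 3}"]) auto

lemma parts_13_cases:
  assumes "set l \<subseteq> {1, 3 :: nat}"
  obtains "l = []" | l' where "l = 1 # l'" "set l' \<subseteq> {1, 3}" | l' where "l = 3 # l'" "set l' \<subseteq> {1, 3}"
  using assms by (cases l) auto

lemma pair_gf_image_Cons:
  assumes "\<And>l m. (l, m) \<in> P \<Longrightarrow> sum_list l = sum_list m"
  shows "pair_gf ((\<lambda>(l, m). (a # l, a # m)) ` P) = var_x ^ a * var_y ^ a * pair_gf P"
  by (rule pair_gf_image) (use assms in \<open>auto simp: inj_on_def ind_Cons_same\<close>)

lemma pair_gf_Nil: "pair_gf {([], [])} = 1"
proof (rule fps_ext)
  fix n
  have "level {([], [])} n = (if n = 0 then {([], [])} else {})" by (auto simp: level_def)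
  then show "pair_gf {([], [])} $ n = 1 $ n" by (simp add: pair_gf_def ind_Nil)
qed

lemma pairs13_eq:
  "pairs13 = {([], [])} \<union> ((\<lambda>(l, m). (1 # l, 1 # m)) ` pairs13 \<union>
    ((\<lambda>(l, m). (3 # l, 3 # m)) ` pairs13 \<union> (pairs3_1 \<union> prod.swap ` pairs3_1)))" (is "_ = ?R")
proof (intro equalityI subsetI)
  fix z assume "z \<in> pairs13"
  then obtain l m where z: "z = (l, m)" "set l \<subseteq> {1, 3}" "set m \<subseteq> {1, 3}" "sum_list l = sum_list m"
    by (auto simp: pairs_def)
  show "z \<in> ?R"
  proof (cases rule: parts_13_cases[OF z(2)])
    case 1
    then show ?thesis using z by (cases rule: parts_13_cases[OF z(3)]) auto
  next
    case (2 l')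
    then show ?thesis
      using z by (cases rule: parts_13_cases[OF z(3)]) (auto simp: pairs_def pairs3_1_def image_iff)
  next
    case (3 l')
    then show ?thesis
      using z by (cases rule: parts_13_cases[OF z(3)]) (auto simp: pairs_def pairs3_1_def image_iff)
  qed
qed (auto simp: pairs_def pairs3_1_def)

lemma pair_gf_swap:
  assumes "\<And>l m. (l, m) \<in> P \<Longrightarrow> sum_list l = sum_list m"
  shows "pair_gf (prod.swap ` P) = pair_gf P"
proof -
  have "sum_list (fst z) = sum_list (snd z)" if "z \<in> P" for z
    using assms[of "fst z" "snd z"] that by simp
  then have "pair_gf (prod.swap ` P) = var_x ^ 0 * var_y ^ 0 * pair_gf P"
    using ind_swap by (intro pair_gf_image) simp_all
  then show ?thesis by simp
qed

text \<open>The cases are the possible pairs of first parts. Those with 1 above 3 mirror those with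
  3 above 1, whence the factor 2.\<close>

lemma pair_gf_pairs13:
  "pair_gf pairs13 = 1 + var_x * var_y * pair_gf pairs13 + var_x ^ 3 * var_y ^ 3 * pair_gf pairs13
    + 2 * pair_gf pairs3_1"
proof -
  define A B C D where "A = (\<lambda>(l, m). (1 # l, 1 # m)) ` pairs13"
    and "B = (\<lambda>(l, m). (3 # l, 3 # m)) ` pairs13"
    and "C = pairs3_1" and "D = prod.swap ` pairs3_1"
  have A: "pair_gf A = var_x * var_y * pair_gf pairs13"
    using pair_gf_image_Cons[of pairs13 1] by (simp add: A_def pairs_def)
  have B: "pair_gf B = var_x ^ 3 * var_y ^ 3 * pair_gf pairs13"
    unfolding B_def by (rule pair_gf_image_Cons) (simp add: pairs_def)
  have D: "pair_gf D = pair_gf C"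
    unfolding C_def D_def by (rule pair_gf_swap) (auto simp: pairs3_1_def pairs_def)
  have eq: "pairs13 = {([], [])} \<union> (A \<union> (B \<union> (C \<union> D)))"
    unfolding A_def B_def C_def D_def by (rule pairs13_eq)
  have disj: "{([], [])} \<inter> (A \<union> (B \<union> (C \<union> D))) = {}" "A \<inter> (B \<union> (C \<union> D)) = {}"
      "B \<inter> (C \<union> D) = {}" "C \<inter> D = {}"
    by (auto simp: A_def B_def C_def D_def pairs3_1_def)
  have "pair_gf pairs13 = pair_gf {([], [])} + pair_gf (A \<union> (B \<union> (C \<union> D)))"
    by (subst eq, rule pair_gf_Un13) (use eq disj in blast)+
  also have "pair_gf (A \<union> (B \<union> (C \<union> D))) = pair_gf A + pair_gf (B \<union> (C \<union> D))"
    by (rule pair_gf_Un13) (use eq disj in blast)+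
  also have "pair_gf (B \<union> (C \<union> D)) = pair_gf B + pair_gf (C \<union> D)"
    by (rule pair_gf_Un13) (use eq disj in blast)+
  also have "pair_gf (C \<union> D) = pair_gf C + pair_gf D"
    by (rule pair_gf_Un13) (use eq disj in blast)+
  finally show ?thesis by (simp add: A B D pair_gf_Nil C_def algebra_simps)
qed

lemma pairs13_sum_eq:
  "(l, m) \<in> pairs13 \<Longrightarrow> sum_list l = sum_list m" "(l, m) \<in> pairs1 \<Longrightarrow> sum_list l = sum_list m"
  by (auto simp: pairs_def pairs1_def)

lemma pair_gf_pairs1:
  "pair_gf pairs1 = var_x * var_y * pair_gf pairs13 + pair_gf pairs3_1"
proof -
  let ?A = "(\<lambda>(l, m). (1 # l, 1 # m)) ` pairs13"
  have eq: "pairs1 = ?A \<union> pairs3_1"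
  proof (intro equalityI subsetI)
    fix z assume "z \<in> pairs1"
    then obtain l m where z: "z = (l, 1 # m)" "set l \<subseteq> {1, 3}" "set m \<subseteq> {1, 3}" "sum_list l = 1 + sum_list m"
      by (auto simp: pairs_def pairs1_def)
    then show "z \<in> ?A \<union> pairs3_1"
      by (cases rule: parts_13_cases[OF z(2)]) (auto simp: pairs_def pairs3_1_def image_iff)
  qed (auto simp: pairs_def pairs1_def pairs3_1_def)
  have "pair_gf (?A \<union> pairs3_1) = pair_gf ?A + pair_gf pairs3_1"
    by (rule pair_gf_Un13) (auto simp: pairs_def pairs3_1_def)
  moreover have "pair_gf ?A = var_x ^ 1 * var_y ^ 1 * pair_gf pairs13"
    by (rule pair_gf_image_Cons) (rule pairs13_sum_eq)
  ultimately show ?thesis by (simp only: eq power_one_right)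
qed

text \<open>If the upper composition begins with 1, cancelling it leaves a lower composition that
  still begins with 1.\<close>

lemma pair_gf_pairs11:
  "pair_gf pairs11 = var_x * var_y * pair_gf pairs1 + pair_gf pairs3_11"
proof -
  let ?A = "(\<lambda>(l, m). (1 # l, 1 # m)) ` pairs1"
  have eq: "pairs11 = ?A \<union> pairs3_11"
  proof (intro equalityI subsetI)
    fix z assume "z \<in> pairs11"
    then obtain l m where z: "z = (l, 1 # 1 # m)" "set l \<subseteq> {1, 3}" "set m \<subseteq> {1, 3}" "sum_list l = 2 + sum_list m"
      by (auto simp: pairs_def pairs11_def)
    then show "z \<in> ?A \<union> pairs3_11"
      by (cases rule: parts_13_cases[OF z(2)]) (auto simp: pairs_def pairs1_def pairs3_11_def image_iff)
  qed (auto simp: pairs_def pairs1_def pairs11_def pairs3_11_def)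
  have "pair_gf (?A \<union> pairs3_11) = pair_gf ?A + pair_gf pairs3_11"
    by (rule pair_gf_Un13) (auto simp: pairs_def pairs1_def pairs3_11_def)
  moreover have "pair_gf ?A = var_x ^ 1 * var_y ^ 1 * pair_gf pairs1"
    by (rule pair_gf_image_Cons) (rule pairs13_sum_eq)
  ultimately show ?thesis by (simp only: eq power_one_right)
qed

text \<open>The upper part 3 forces a second lower part. If that is 3, \<open>ind_3_13\<close>
  reduces to a pair in \<open>pairs1\<close>; if it is 1, the pair lies in
  \<open>pairs3_11\<close>.\<close>

lemma pair_gf_pairs3_1:
  "pair_gf pairs3_1 = var_x ^ 3 * var_y * pair_gf pairs1 + pair_gf pairs3_11"
proof -
  \<comment> \<open>A lower composition in \<open>pairs1\<close> begins with 1, which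
    \<open>tl\<close> strips, so \<open>h\<close> inserts a 3 right after that 1.\<close>
  define h where "h z = (3 # fst z, 1 # 3 # tl (snd z))" for z :: "nat list \<times> nat list"
  have eq: "pairs3_1 = h ` pairs1 \<union> pairs3_11"
  proof (intro equalityI subsetI)
    fix z assume "z \<in> pairs3_1"
    then obtain l m where z: "z = (3 # l, 1 # m)" "set l \<subseteq> {1, 3}" "set m \<subseteq> {1, 3}" "2 + sum_list l = sum_list m"
      by (auto simp: pairs_def pairs3_1_def)
    show "z \<in> h ` pairs1 \<union> pairs3_11"
    proof (cases rule: parts_13_cases[OF z(3)])
      case (3 m')
      then have "z = h (l, 1 # m')" "(l, 1 # m') \<in> pairs1"
        using z by (auto simp: h_def pairs1_def pairs_def)
      then show ?thesis by blast
    qed (use z in \<open>auto simp: pairs_def pairs3_11_def\<close>)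
  qed (auto simp: h_def pairs_def pairs1_def pairs3_1_def pairs3_11_def)
  have "pair_gf (h ` pairs1 \<union> pairs3_11) = pair_gf (h ` pairs1) + pair_gf pairs3_11"
    by (rule pair_gf_Un13) (auto simp: h_def pairs_def pairs1_def pairs3_11_def)
  moreover have "pair_gf (h ` pairs1) = var_x ^ 3 * var_y ^ 1 * pair_gf pairs1"
  proof (rule pair_gf_image)
    show "inj_on h pairs1" by (auto simp: h_def inj_on_def pairs1_def)
    fix z assume "z \<in> pairs1"
    then obtain l m where z: "z = (l, 1 # m)" "sum_list l = Suc (sum_list m)"
      by (auto simp: pairs1_def pairs_def)
    show "sum_list (fst (h z)) = 3 + sum_list (fst z)" by (simp add: h_def)
    show "ind (fst (h z)) (snd (h z)) = 1 + ind (fst z) (snd z)"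
      unfolding z(1) h_def fst_conv snd_conv list.sel using z(2) by (rule ind_3_13)
  qed
  ultimately show ?thesis by (simp only: eq power_one_right)
qed

text \<open>Here the third lower part decides: 1 closes off a block of three vertices, while 3 is
  reduced by \<open>ind_3_113\<close>.\<close>

lemma pair_gf_pairs3_11:
  "pair_gf pairs3_11 = var_x ^ 3 * var_y ^ 2 * pair_gf pairs13 + var_x ^ 3 * var_y * pair_gf pairs11"
proof -
  define g where "g z = (3 # fst z, 1 # 1 # 1 # snd z)" for z :: "nat list \<times> nat list"
  define h where "h z = (3 # fst z, 1 # 1 # 3 # tl (tl (snd z)))" for z :: "nat list \<times> nat list"
  have eq: "pairs3_11 = g ` pairs13 \<union> h ` pairs11"
  proof (intro equalityI subsetI)
    fix z assume "z \<in> pairs3_11"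
    then obtain l m where z: "z = (3 # l, 1 # 1 # m)" "set l \<subseteq> {1, 3}" "set m \<subseteq> {1, 3}" "1 + sum_list l = sum_list m"
      by (auto simp: pairs_def pairs3_11_def)
    show "z \<in> g ` pairs13 \<union> h ` pairs11"
    proof (cases rule: parts_13_cases[OF z(3)])
      case 1
      then show ?thesis using z(4) by simp
    next
      case (2 m')
      then have "z = g (l, m')" "(l, m') \<in> pairs13"
        using z by (auto simp: g_def pairs_def)
      then show ?thesis by blast
    next
      case (3 m')
      then have "z = h (l, 1 # 1 # m')" "(l, 1 # 1 # m') \<in> pairs11"
        using z by (auto simp: h_def pairs11_def pairs_def)
      then show ?thesis by blast
    qed
  qed (auto simp: g_def h_def pairs_def pairs11_def pairs3_11_def)
  have "pair_gf (g ` pairs13 \<union> h ` pairs11) = pair_gf (g ` pairs13) + pair_gf (h ` pairs11)"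
    by (rule pair_gf_Un13) (auto simp: g_def h_def pairs_def pairs11_def)
  moreover have "pair_gf (g ` pairs13) = var_x ^ 3 * var_y ^ 2 * pair_gf pairs13"
  proof (rule pair_gf_image)
    show "inj_on g pairs13" by (auto simp: g_def inj_on_def)
    fix z assume "z \<in> pairs13"
    then obtain l m where z: "z = (l, m)" "sum_list l = sum_list m"
      by (auto simp: pairs_def)
    show "sum_list (fst (g z)) = 3 + sum_list (fst z)" by (simp add: g_def)
    show "ind (fst (g z)) (snd (g z)) = 2 + ind (fst z) (snd z)"
      unfolding z(1) g_def fst_conv snd_conv using z(2) by (rule ind_3_111)
  qed
  moreover have "pair_gf (h ` pairs11) = var_x ^ 3 * var_y ^ 1 * pair_gf pairs11"
  proof (rule pair_gf_image)
    show "inj_on h pairs11" by (auto simp: h_def inj_on_def pairs11_def)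
    fix z assume "z \<in> pairs11"
    then obtain l m where z: "z = (l, 1 # 1 # m)" "sum_list l = 2 + sum_list m"
      by (auto simp: pairs11_def pairs_def)
    show "sum_list (fst (h z)) = 3 + sum_list (fst z)" by (simp add: h_def)
    show "ind (fst (h z)) (snd (h z)) = 1 + ind (fst z) (snd z)"
      unfolding z(1) h_def fst_conv snd_conv list.sel using z(2) by (rule ind_3_113)
  qed
  ultimately show ?thesis by (simp only: eq power_one_right)
qed

text \<open>Elimination of \<open>G1\<close>, \<open>G2\<close> and \<open>T2\<close> leaves one
  relation between \<open>T\<close> and \<open>G\<close> times a nonzero factor. Cancelling this
  factor and inserting the relation into the first equation gives the claim.\<close>

lemma linear_system_solution:
  fixes x y :: "'a :: idom"
  assumes G: "G = 1 + x * y * G + x ^ 3 * y ^ 3 * G + 2 * T"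
    and G1: "G1 = x * y * G + T"
    and G2: "G2 = x * y * G1 + T2"
    and T: "T = x ^ 3 * y * G1 + T2"
    and T2: "T2 = x ^ 3 * y ^ 2 * G + x ^ 3 * y * G2"
    and unit: "1 - x ^ 3 * y + x ^ 2 * y \<noteq> 0"
  shows "G * ((1 - x ^ 2 * y - x ^ 3 * y) * (1 - x * y - x ^ 3 * y ^ 3) - 2 * x ^ 3 * y ^ 2 * (1 + x))
    = 1 - x ^ 2 * y - x ^ 3 * y"
proof -
  let ?N = "1 - x ^ 2 * y - x ^ 3 * y"
  have T2': "T2 = T - x ^ 3 * y * (x * y * G + T)" using T G1 by (simp add: algebra_simps)
  have G2': "G2 = x * y * (x * y * G + T) + T2" using G2 G1 by simp
  \<comment> \<open>With \<open>a = x^3 y\<close> and \<open>b = x^2 y\<close> the coefficient of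
    \<open>T\<close> is \<open>(1 - a)^2 - b^2\<close>, which factors as
    \<open>(1 - a - b) * (1 - a + b)\<close>. The coefficient of \<open>G\<close> also contains
    \<open>1 - a + b\<close>.\<close>
  have "(1 - x ^ 3 * y + x ^ 2 * y) * (?N * T - x ^ 3 * y ^ 2 * (1 + x) * G)
    = T2 - x ^ 3 * y ^ 2 * G - x ^ 3 * y * G2"
    using G2' T2' by algebra
  also have "\<dots> = 0" using T2 by (simp add: algebra_simps)
  finally have NT: "?N * T = x ^ 3 * y ^ 2 * (1 + x) * G" using unit by simp
  have GT: "G * (1 - x * y - x ^ 3 * y ^ 3) = 1 + 2 * T"
    using G by (simp add: algebra_simps)
  have "?N * (G * (1 - x * y - x ^ 3 * y ^ 3)) = ?N + 2 * (?N * T)"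
    unfolding GT by (simp add: algebra_simps)
  then show ?thesis unfolding NT by (simp add: algebra_simps)
qed

lemma meander_gf_13:
  "meander_gf {1, 3} = (1 - var_x^2 * var_y - var_x^3 * var_y) /
     ((1 - var_x^2 * var_y - var_x^3 * var_y) * (1 - var_x * var_y - var_x^3 * var_y^3)
        - 2 * var_x^3 * var_y^2 * (1 + var_x))" (is "_ = ?N / ?D")
proof -
  have D0: "?D $ 0 = 1" by (simp add: fps_mult_nth_0)
  have "(1 - var_x ^ 3 * var_y + var_x ^ 2 * var_y) $ 0 = 1" by (simp add: fps_mult_nth_0)
  then have unit: "1 - var_x ^ 3 * var_y + var_x ^ 2 * var_y \<noteq> 0"
    by (metis fps_zero_nth zero_neq_one)
  have gf: "meander_gf {1, 3} = pair_gf pairs13"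
    by (rule meander_gf_eq_pair_gf) simp_all
  have "meander_gf {1, 3} * ?D = ?N"
    unfolding gf
    using pair_gf_pairs13 pair_gf_pairs1 pair_gf_pairs11 pair_gf_pairs3_1 pair_gf_pairs3_11 unit
    by (rule linear_system_solution)
  \<comment> \<open>The constant coefficient 1 makes the division exact, and then \<open>?D\<close>
    can be cancelled on both sides.\<close>
  also have "?N = ?N / ?D * ?D" using bivariate_divide_mult_cancel[OF D0] by simp
  finally show ?thesis using D0 by (metis fps_zero_nth mult_right_cancel zero_neq_one)
qed

section \<open>Scaling of the parts\<close>

text \<open>The number \<open>c * i + r\<close> is position \<open>r\<close> in block
  \<open>i\<close>. Scaling the parts reflects the block numbers as before and reverses the
  positions within each block.\<close>

lemma reflect_map_times:
  assumes "r < c"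
  shows "reflect (map ((*) c) as) (c * i + r) =
    (if i < sum_list as then c * reflect as i + (c - 1 - r) else c * i + r)"
proof (induction as arbitrary: i)
  case (Cons a as)
  have lt: "c * i + r < c * a \<longleftrightarrow> i < a"
  proof
    assume "c * i + r < c * a"
    then have "c * i < c * a" by linarith
    then show "i < a" by simp
  next
    assume "i < a"
    then have "c * Suc i \<le> c * a" by (intro mult_le_mono) auto
    then show "c * i + r < c * a" using assms by simp
  qed
  show ?case
  proof (cases "i < a")
    case True
    then obtain d where "a = Suc (i + d)" using less_imp_Suc_add by blast
    then show ?thesis using True lt assms by (auto simp: algebra_simps)
  next
    case False
    then obtain d where d: "i = a + d" by (metis le_Suc_ex not_less)
    have "c * i + r - c * a = c * d + r" by (simp add: d algebra_simps)
    then show ?thesis using False lt Cons.IH[of d] by (simp add: d algebra_simps)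
  qed
qed simp

lemma sum_list_map_times: "sum_list (map ((*) c) as) = c * sum_list as" for c :: nat
  by (simp add: sum_list_const_mult)

text \<open>Both reflections reverse positions within blocks, so their composite preserves the
  residue \<open>r\<close> modulo \<open>c\<close> and acts as \<open>p\<close> on block numbers.
  Each of the \<open>c\<close> residue classes is a copy of the original permutation.\<close>

lemma ind_map_times:
  assumes "0 < c" "sum_list l = sum_list m"
  shows "ind (map ((*) c) l) (map ((*) c) m) = c * ind l m"
proof -
  define n where "n = sum_list l"
  define p where "p = reflect l \<circ> reflect m"
  define q where "q = reflect (map ((*) c) l) \<circ> reflect (map ((*) c) m)"
  have p: "p ` {..<n} \<subseteq> {..<n}"
    unfolding p_def using assms(2) by (intro comp_reflect_closed) (auto simp: n_def)
  have q: "q (c * i + r) = c * p i + r" if "i < n" "r < c" for i r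
    using that assms(2) reflect_map_times[OF that(2), of m i]
      reflect_map_times[of "c - 1 - r" c l "reflect m i"] reflect_less[of i m]
    by (simp add: p_def q_def n_def)
  have block: "orbit_count q ((\<lambda>i. c * i + r) ` {..<n}) = orbit_count p {..<n}" if "r < c" for r
    by (rule orbit_count_image) (use that p q assms(1) in \<open>auto simp: inj_on_def\<close>)
  have closed: "q ` (\<lambda>i. c * i + r) ` {..<n} \<subseteq> (\<lambda>i. c * i + r) ` {..<n}" if "r < c" for r
    using that p q by (auto simp: image_subset_iff)
  let ?B = "\<lambda>r. (\<lambda>i. c * i + r) ` {..<n}"
  have "{..<c * n} = (\<Union>r<c. ?B r)"
  proof (intro equalityI subsetI)
    fix v assume "v \<in> {..<c * n}"
    then have "v div c < n" "v mod c < c" "v = c * (v div c) + v mod c"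
      using assms(1) by (auto simp: less_mult_imp_div_less mult.commute)
    then show "v \<in> (\<Union>r<c. ?B r)" by blast
  next
    fix v assume "v \<in> (\<Union>r<c. ?B r)"
    then obtain r i where "r < c" "i < n" "v = c * i + r" by auto
    moreover from this have "c * Suc i \<le> c * n" by (intro mult_le_mono) auto
    ultimately show "v \<in> {..<c * n}" by simp
  qed
  \<comment> \<open>The residue classes are added one at a time; the bound on \<open>k\<close> keeps
    the residues below \<open>c\<close>, hence the classes disjoint.\<close>
  moreover have "orbit_count q (\<Union>r<k. ?B r) = k * orbit_count p {..<n}" if "k \<le> c" for k
    using that
  proof (induction k)
    case 0
    then show ?case by (simp add: orbit_count_def quotient_def)
  next
    case (Suc k)
    have "orbit_count q (?B k \<union> (\<Union>r<k. ?B r)) = orbit_count q (?B k) + orbit_count q (\<Union>r<k. ?B r)"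
    proof (rule orbit_count_Un)
      show "?B k \<inter> (\<Union>r<k. ?B r) = {}"
      proof (rule ccontr)
        assume "?B k \<inter> (\<Union>r<k. ?B r) \<noteq> {}"
        then obtain r i j where "r < k" "c * i + k = c * j + r" by auto
        then have "(c * i + k) mod c = (c * j + r) mod c" by simp
        then show False using \<open>r < k\<close> Suc.prems by simp
      qed
      show "q ` ?B k \<subseteq> ?B k" using closed[of k] Suc.prems by simp
      show "q ` (\<Union>r<k. ?B r) \<subseteq> (\<Union>r<k. ?B r)"
        unfolding image_UN using closed Suc.prems by (intro UN_mono) auto
    qed auto
    then show ?case using Suc block[of k] by (simp add: lessThan_Suc)
  qed
  ultimately have "orbit_count q {..<c * n} = c * orbit_count p {..<n}" by simp
  then show ?thesis by (simp only: ind_def sum_list_map_times n_def p_def q_def)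
qed

lemma fps_nth_compose_X_power:
  fixes f :: "'a :: comm_ring_1 fps"
  assumes "0 < c"
  shows "(f oo fps_X ^ c) $ n = (if c dvd n then f $ (n div c) else 0)"
proof -
  have sum: "(f oo fps_X ^ c) $ n = (\<Sum>i=0..n. if c * i = n then f $ i else 0)"
    unfolding fps_compose_nth by (intro sum.cong) (auto simp flip: power_mult)
  show ?thesis
  proof (cases "c dvd n")
    case True
    then obtain k where k: "n = c * k" by auto
    have "(\<Sum>i=0..n. if c * i = n then f $ i else 0) = (\<Sum>i=0..n. if i = k then f $ i else 0)"
      using assms k by (intro sum.cong) auto
    also have "\<dots> = f $ k" using assms k by simp
    finally show ?thesis using assms k sum by simp
  next
    case False
    then show ?thesis unfolding sum by (auto intro!: sum.neutral)
  qed
qed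

lemma pairs_times:
  assumes "0 < c"
  shows "pairs ((*) c ` J) = map_prod (map ((*) c)) (map ((*) c)) ` pairs J"
proof (intro equalityI subsetI)
  fix z assume "z \<in> pairs ((*) c ` J)"
  then obtain l m where z: "z = (l, m)" "set l \<subseteq> (*) c ` J" "set m \<subseteq> (*) c ` J"
      "sum_list l = sum_list m"
    by (auto simp: pairs_def)
  have "l \<in> map ((*) c) ` lists J" "m \<in> map ((*) c) ` lists J"
    using z(2,3) unfolding lists_image[symmetric] by auto
  then obtain l' m' where lm: "l = map ((*) c) l'" "m = map ((*) c) m'" "set l' \<subseteq> J" "set m' \<subseteq> J"
    by (auto simp: lists_eq_set)
  then have "sum_list l' = sum_list m'"
    using z(4) assms by (simp add: sum_list_map_times)
  then have "(l', m') \<in> pairs J" using lm by (simp add: pairs_def)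
  then show "z \<in> map_prod (map ((*) c)) (map ((*) c)) ` pairs J"
    using z(1) lm by force
qed (auto simp: pairs_def sum_list_map_times intro!: imageI)

text \<open>Multiplying all parts by \<open>c\<close> is a bijection of pairs that multiplies both
  size and index by \<open>c\<close>. Sizes that \<open>c\<close> does not divide do not occur on
  the left, and their coefficients vanish on the right.\<close>

lemma meander_gf_times:
  assumes "0 < c" "finite J" "0 \<notin> J"
  shows "meander_gf ((*) c ` J) = subst_powers c (meander_gf J)"
proof (rule fps_ext)
  fix n
  define h where "h = map_prod (map ((*) c)) (map ((*) c))"
  have inj: "inj h"
    unfolding h_def using assms(1) by (intro prod.inj_map inj_mapI) (auto simp: inj_on_def)
  have gf: "meander_gf ((*) c ` J) = pair_gf (h ` pairs J)"
    unfolding h_def pairs_times[OF assms(1), symmetric]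
    using assms by (intro meander_gf_eq_pair_gf) auto
  have fst_h: "sum_list (fst (h z)) = c * sum_list (fst z)" for z
    by (cases z) (simp add: h_def sum_list_map_times)
  show "meander_gf ((*) c ` J) $ n = subst_powers c (meander_gf J) $ n"
  proof (cases "c dvd n")
    case True
    then obtain k where k: "n = c * k" by auto
    have lev: "level (h ` pairs J) n = h ` level (pairs J) k"
      using assms(1) k by (auto simp: level_def fst_h)
    have "meander_gf ((*) c ` J) $ n = (\<Sum>z\<in>level (pairs J) k. fps_X ^ ind (fst (h z)) (snd (h z)))"
      using inj_on_subset[OF inj] by (simp add: gf pair_gf_def lev sum.reindex)
    also have "\<dots> = (\<Sum>z\<in>level (pairs J) k. fps_X ^ ind (fst z) (snd z) oo fps_X ^ c)"
    proof (rule sum.cong)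
      fix z assume "z \<in> level (pairs J) k"
      then have "ind (fst (h z)) (snd (h z)) = c * ind (fst z) (snd z)"
        using assms(1) by (auto simp: level_def pairs_def h_def ind_map_times)
      then show "fps_X ^ ind (fst (h z)) (snd (h z)) = fps_X ^ ind (fst z) (snd z) oo (fps_X ^ c :: rat fps)"
        using assms(1) by (simp add: power_mult flip: fps_compose_power)
    qed simp
    also have "\<dots> = pair_gf (pairs J) $ k oo fps_X ^ c"
      by (simp add: pair_gf_def fps_compose_sum_distrib)
    finally show ?thesis
      using assms k by (simp add: subst_powers_def fps_nth_compose_X_power meander_gf_eq_pair_gf)
  next
    case False
    then have "sum_list (fst (h z)) \<noteq> n" for z unfolding fst_h by auto
    then have "level (h ` pairs J) n = {}" unfolding level_def by blast
    then show ?thesis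
      using False assms(1) by (simp add: gf pair_gf_def subst_powers_def fps_nth_compose_X_power)
  qed
qed

theorem theorem3p6:
  shows "meander_gf {1, 3} =
           (1 - var_x^2 * var_y - var_x^3 * var_y) /
           ((1 - var_x^2 * var_y - var_x^3 * var_y) * (1 - var_x * var_y - var_x^3 * var_y^3)
              - 2 * var_x^3 * var_y^2 * (1 + var_x))
         \<and> (\<forall>c::nat. c \<ge> 1 \<longrightarrow> meander_gf {c, 3 * c} = subst_powers c (meander_gf {1, 3}))"
proof (intro conjI allI impI)
  fix c :: nat
  assume "c \<ge> 1"
  then have "meander_gf ((*) c ` {1, 3}) = subst_powers c (meander_gf {1, 3})"
    by (intro meander_gf_times) auto
  moreover have "(*) c ` {1, 3} = {c, 3 * c}" by auto
  ultimately show "meander_gf {c, 3 * c} = subst_powers c (meander_gf {1, 3})" by simp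
qed (rule meander_gf_13)

end
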